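(* Let $H$ be a real Hilbert space with a compatible triple $(g,J,\omega)$, and let $S_1,S_2$ be finite subsets of the index set of the chosen orthonormal basis $\{e_i\}_{i\ge1}$ of $L^+$. Let $a,b,c,d$ be the operators such that $\begin{pmatrix}a&b\\c&d\end{pmatrix}:W_{S_1}\oplus W_{S_1}^\perp\to W_{S_2}\oplus W_{S_2}^\perp$ is the identity operator of $H_{\mathbb{C}}$. Then the transition function $$\{Z\in\mathcal{B}_2^\alpha(W_{S_1},W_{S_1}^\perp)\mid a+bZ \text{ has a bounded inverse}\}\to\mathcal{B}_2^\alpha(W_{S_2},W_{S_2}^\perp),\qquad Z\mapsto(c+dZ)(a+bZ)^{-1},$$ is holomorphic.
   Context: Hilbert spaces are separable, possibly finite-dimensional. A compatible triple $(g,J,\omega)$ on a real Hilbert space $H$ consists of: a strong inner product $g$ (continuous symmetric bilinear form, $g(v,v)\ge0$, such that $v\mapsto g(v,\cdot)$ is a bounded isomorphism $H\to H^*$); a complex structure $J$ (continuous linear, $J^2=-\mathrm{id}$); and a strong symplectic form $\omega$ (continuous anti-symmetric bilinear form such that $v\mapsto\omega(v,\cdot)$ is a bounded isomorphism $H\to H^*$), with $g(v,w)=\omega(v,Jw)$. $H_{\mathbb{C}}=H\otimes_{\mathbb{R}}\mathbb{C}$, and $\alpha:H_{\mathbb{C}}\to H_{\mathbb{C}}$ is the conjugate-linear involution extending $v\otimes\lambda\mapsto v\otimes\overline\lambda$. $J$ is extended complex-linearly and $g$ sesquilinearly to $H_{\mathbb{C}}$. $L^{\pm}=\ker(J\mp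 i)$; then $H_{\mathbb{C}}=L^+\oplus L^-$ orthogonally and $\alpha(L^+)=L^-$. Fix an orthonormal basis $\{e_i\}_{i\ge1}$ of $L^+$ (indexed by the positive integers, or by $1,\dots,\dim L^+$ if $L^+$ is finite-dimensional), and set $e_{i}=\alpha e_{-i}$ for $i\le-1$, an orthonormal basis of $L^-$. For a finite subset $S$ of the index set of positive integers, $W_S$ is the closed linear span of $\{e_k,e_{-l}\mid k\ge1,\ k\notin S,\ l\in S\}$; its orthogonal complement is $W_S^\perp=\alpha(W_S)$. $\mathcal{B}_2^\alpha(W_S,W_S^\perp)$ is the complex Hilbert space of Hilbert–Schmidt operators $Z:W_S\to W_S^\perp$ satisfying $\alpha Z\alpha=-Z^*$. These transition functions are those of the charts $\mathcal{O}_S\to\mathcal{B}_2^\alpha(W_S,W_S^\perp)$, $\operatorname{graph}(Z)\mapsto Z$, of the restricted Lagrangian Grassmannian $\mathrm{Pol}_2^g(H)$ consisting of the closed subspaces $W^+\subset H_{\mathbb{C}}$ such that $H_{\mathbb{C}}=W^+\oplus\alpha(W^+)$ orthogonally and the orthogonal projection $H_{\mathbb{C}}\to\alpha(W^+)$ restricted to $L^+$ is Hilbert–Schmidt; here $\mathcal{O}_S=\{\operatorname{graph}(Z)\in\mathrm{Pol}_2^g(H)\mid Z\in\mathcal{B}_2^\alpha(W_S,W_S^\perp)\}$. *)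

theory Defs
  imports "HOL-Analysis.Analysis"
begin

section \<open>Compatible triples on a real Hilbert space\<close>

definition bounded_isomorphism ::
    "('a::real_normed_vector \<Rightarrow> 'b::real_normed_vector) \<Rightarrow> bool" where
  "bounded_isomorphism f \<longleftrightarrow> bounded_linear f \<and> bij f \<and> bounded_linear (inv f)"

text \<open>The map \<open>v \<mapsto> b(v, \<cdot>)\<close> into the dual space, which is the type \<open>'a \<Rightarrow>\<^sub>L real\<close>.\<close>

definition to_dual :: "('a::real_normed_vector \<Rightarrow> 'a \<Rightarrow> real) \<Rightarrow> 'a \<Rightarrow> ('a \<Rightarrow>\<^sub>L real)" where
  "to_dual b v = Blinfun (b v)"

definition strong_inner_product :: "('a::real_normed_vector \<Rightarrow> 'a \<Rightarrow> real) \<Rightarrow> bool" where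
  "strong_inner_product g \<longleftrightarrow>
     bounded_bilinear g \<and> (\<forall>v w. g v w = g w v) \<and> (\<forall>v. 0 \<le> g v v) \<and>
     bounded_isomorphism (to_dual g)"

definition strong_symplectic_form :: "('a::real_normed_vector \<Rightarrow> 'a \<Rightarrow> real) \<Rightarrow> bool" where
  "strong_symplectic_form \<omega> \<longleftrightarrow>
     bounded_bilinear \<omega> \<and> (\<forall>v w. \<omega> v w = - \<omega> w v) \<and> bounded_isomorphism (to_dual \<omega>)"

definition complex_structure :: "('a::real_normed_vector \<Rightarrow> 'a) \<Rightarrow> bool" where
  "complex_structure J \<longleftrightarrow> bounded_linear J \<and> (\<forall>v. J (J v) = - v)"

definition compatible_triple ::
    "('a::real_normed_vector \<Rightarrow> 'a \<Rightarrow> real) \<Rightarrow> ('a \<Rightarrow> 'a) \<Rightarrow> ('a \<Rightarrow> 'a \<Rightarrow> real) \<Rightarrow> bool" where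
  "compatible_triple g J \<omega> \<longleftrightarrow>
     strong_inner_product g \<and> complex_structure J \<and> strong_symplectic_form \<omega> \<and>
     (\<forall>v w. g v w = \<omega> v (J w))"

section \<open>The complexification\<close>

text \<open>
  The complexification of \<open>H\<close> is \<open>H \<times> H\<close>, the pair \<open>(x, y)\<close> standing for
  \<open>x \<otimes> 1 + y \<otimes> \<i>\<close>.  Its topology is the product topology.
\<close>

type_synonym 'a cplxn = "'a \<times> 'a"

definition cscale :: "complex \<Rightarrow> 'a::real_vector cplxn \<Rightarrow> 'a cplxn" where
  "cscale c z = (Re c *\<^sub>R fst z - Im c *\<^sub>R snd z, Re c *\<^sub>R snd z + Im c *\<^sub>R fst z)"

lemma vector_space_cscale: "vector_space (cscale :: complex \<Rightarrow> 'a::real_vector cplxn \<Rightarrow> 'a cplxn)"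
  by unfold_locales (auto simp: cscale_def prod_eq_iff algebra_simps)

abbreviation cspan :: "'a::real_vector cplxn set \<Rightarrow> 'a cplxn set" where
  "cspan \<equiv> module.span cscale"

abbreviation clinear :: "('a::real_vector cplxn \<Rightarrow> 'a cplxn) \<Rightarrow> bool" where
  "clinear \<equiv> Vector_Spaces.linear cscale cscale"

text \<open>The involution \<open>\<alpha>\<close>.\<close>

definition cconj :: "'a::real_vector cplxn \<Rightarrow> 'a cplxn" where
  "cconj z = (fst z, - snd z)"

text \<open>The complex-linear extension of \<open>J\<close>, and the sesquilinear extension of \<open>g\<close> (linear in the
  first argument, conjugate-linear in the second).\<close>

definition J_ext :: "('a \<Rightarrow> 'a) \<Rightarrow> 'a cplxn \<Rightarrow> 'a cplxn" where
  "J_ext J z = (J (fst z), J (snd z))"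

definition g_ext :: "('a \<Rightarrow> 'a \<Rightarrow> real) \<Rightarrow> 'a cplxn \<Rightarrow> 'a cplxn \<Rightarrow> complex" where
  "g_ext g z w =
     Complex (g (fst z) (fst w) + g (snd z) (snd w)) (g (snd z) (fst w) - g (fst z) (snd w))"

definition g_norm :: "('a \<Rightarrow> 'a \<Rightarrow> real) \<Rightarrow> 'a cplxn \<Rightarrow> real" where
  "g_norm g z = sqrt (Re (g_ext g z z))"

definition L_plus :: "('a::real_vector \<Rightarrow> 'a) \<Rightarrow> 'a cplxn set" where
  "L_plus J = {z. J_ext J z = cscale \<i> z}"

definition perp :: "('a \<Rightarrow> 'a \<Rightarrow> real) \<Rightarrow> 'a cplxn set \<Rightarrow> 'a cplxn set" where
  "perp g W = {z. \<forall>w\<in>W. g_ext g z w = 0}"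

definition orthonormal_basis ::
    "('a::real_normed_vector \<Rightarrow> 'a \<Rightarrow> real) \<Rightarrow> 'a cplxn set \<Rightarrow> 'a cplxn set \<Rightarrow> bool" where
  "orthonormal_basis g W B \<longleftrightarrow>
     (\<forall>u\<in>B. \<forall>v\<in>B. g_ext g u v = (if u = v then 1 else 0)) \<and> closure (cspan B) = W"

text \<open>The space \<open>W\<^sub>S\<close>; the vector \<open>e\<^bsub>-l\<^esub>\<close> is \<open>cconj (e l)\<close>, and \<open>I\<close> is the index set of the
  basis of \<open>L\<^sup>+\<close>.\<close>

definition W_space :: "nat set \<Rightarrow> (nat \<Rightarrow> 'a::real_normed_vector cplxn) \<Rightarrow> nat set \<Rightarrow> 'a cplxn set" where
  "W_space I e S = closure (cspan (e ` (I - S) \<union> (\<lambda>l. cconj (e l)) ` S))"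

section \<open>Operators between closed subspaces\<close>

text \<open>
  A bounded complex-linear operator \<open>W \<rightarrow> V\<close> between closed subspaces of the complexification is
  represented by its extension by zero on the orthogonal complement of \<open>W\<close>.  This is compatible
  with composition and with adjoints.
\<close>

definition operators ::
    "('a::real_normed_vector \<Rightarrow> 'a \<Rightarrow> real) \<Rightarrow> 'a cplxn set \<Rightarrow> 'a cplxn set \<Rightarrow>
     ('a cplxn \<Rightarrow>\<^sub>L 'a cplxn) set" where
  "operators g W V =
     {T. clinear (blinfun_apply T) \<and> (\<forall>v. T v \<in> V) \<and> (\<forall>v\<in>perp g W. T v = 0)}"

definition is_bounded_inverse ::
    "('a::real_normed_vector \<Rightarrow> 'a \<Rightarrow> real) \<Rightarrow> 'a cplxn set \<Rightarrow> 'a cplxn set \<Rightarrow>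
     ('a cplxn \<Rightarrow>\<^sub>L 'a cplxn) \<Rightarrow> ('a cplxn \<Rightarrow>\<^sub>L 'a cplxn) \<Rightarrow> bool" where
  "is_bounded_inverse g W V A T \<longleftrightarrow>
     T \<in> operators g V W \<and> (\<forall>w\<in>W. T (A w) = w) \<and> (\<forall>v\<in>V. A (T v) = v)"

definition has_bounded_inverse ::
    "('a::real_normed_vector \<Rightarrow> 'a \<Rightarrow> real) \<Rightarrow> 'a cplxn set \<Rightarrow> 'a cplxn set \<Rightarrow>
     ('a cplxn \<Rightarrow>\<^sub>L 'a cplxn) \<Rightarrow> bool" where
  "has_bounded_inverse g W V A \<longleftrightarrow> (\<exists>T. is_bounded_inverse g W V A T)"

definition inverse_operator ::
    "('a::real_normed_vector \<Rightarrow> 'a \<Rightarrow> real) \<Rightarrow> 'a cplxn set \<Rightarrow> 'a cplxn set \<Rightarrow>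
     ('a cplxn \<Rightarrow>\<^sub>L 'a cplxn) \<Rightarrow> ('a cplxn \<Rightarrow>\<^sub>L 'a cplxn)" where
  "inverse_operator g W V A = (THE T. is_bounded_inverse g W V A T)"

definition adjoint_operator ::
    "('a::real_normed_vector \<Rightarrow> 'a \<Rightarrow> real) \<Rightarrow> ('a cplxn \<Rightarrow>\<^sub>L 'a cplxn) \<Rightarrow> 'a cplxn \<Rightarrow> 'a cplxn" where
  "adjoint_operator g T = (SOME T'. \<forall>v w. g_ext g (T v) w = g_ext g v (T' w))"

definition hilbert_schmidt ::
    "('a::real_normed_vector \<Rightarrow> 'a \<Rightarrow> real) \<Rightarrow> 'a cplxn set \<Rightarrow> ('a cplxn \<Rightarrow>\<^sub>L 'a cplxn) \<Rightarrow> bool" where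
  "hilbert_schmidt g W Z \<longleftrightarrow>
     (\<exists>B. orthonormal_basis g W B \<and> (\<lambda>v. (g_norm g (Z v))\<^sup>2) summable_on B)"

text \<open>The value does not depend on the choice of the orthonormal basis of \<open>W\<close>.\<close>

definition hs_norm ::
    "('a::real_normed_vector \<Rightarrow> 'a \<Rightarrow> real) \<Rightarrow> 'a cplxn set \<Rightarrow> ('a cplxn \<Rightarrow>\<^sub>L 'a cplxn) \<Rightarrow> real" where
  "hs_norm g W Z =
     sqrt (infsum (\<lambda>v. (g_norm g (Z v))\<^sup>2) (SOME B. orthonormal_basis g W B))"

text \<open>The space \<open>B\<^sub>2\<^sup>\<alpha>(W, V)\<close>, for \<open>V\<close> the orthogonal complement of \<open>W\<close>.\<close>

definition B2_alpha ::
    "('a::real_normed_vector \<Rightarrow> 'a \<Rightarrow> real) \<Rightarrow> 'a cplxn set \<Rightarrow> ('a cplxn \<Rightarrow>\<^sub>L 'a cplxn) set" where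
  "B2_alpha g W =
     {Z \<in> operators g W (perp g W). hilbert_schmidt g W Z \<and>
        (\<forall>v. cconj (Z (cconj v)) = - adjoint_operator g Z v)}"

section \<open>Holomorphic maps between complex normed spaces of operators\<close>

definition op_cscale ::
    "complex \<Rightarrow> ('a::real_normed_vector cplxn \<Rightarrow>\<^sub>L 'a cplxn) \<Rightarrow> ('a cplxn \<Rightarrow>\<^sub>L 'a cplxn)" where
  "op_cscale c T = Blinfun (\<lambda>v. cscale c (T v))"

text \<open>
  \<open>E\<close> and \<open>F\<close> are complex vector spaces of operators, with norms \<open>nE\<close> and \<open>nF\<close> (in general not the
  operator norm).  A map from \<open>U \<subseteq> E\<close> to \<open>F\<close> is holomorphic if \<open>U\<close> is open in \<open>E\<close> and the map is
  complex Frechet differentiable at each point of \<open>U\<close>.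
\<close>

definition bounded_clinear_between ::
    "('a::real_normed_vector cplxn \<Rightarrow>\<^sub>L 'a cplxn) set \<Rightarrow> (('a cplxn \<Rightarrow>\<^sub>L 'a cplxn) \<Rightarrow> real) \<Rightarrow>
     ('a cplxn \<Rightarrow>\<^sub>L 'a cplxn) set \<Rightarrow> (('a cplxn \<Rightarrow>\<^sub>L 'a cplxn) \<Rightarrow> real) \<Rightarrow>
     (('a cplxn \<Rightarrow>\<^sub>L 'a cplxn) \<Rightarrow> ('a cplxn \<Rightarrow>\<^sub>L 'a cplxn)) \<Rightarrow> bool" where
  "bounded_clinear_between E nE F nF D \<longleftrightarrow>
     D \<in> E \<rightarrow> F \<and>
     (\<forall>X\<in>E. \<forall>Y\<in>E. D (X + Y) = D X + D Y) \<and>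
     (\<forall>c. \<forall>X\<in>E. D (op_cscale c X) = op_cscale c (D X)) \<and>
     (\<exists>K. \<forall>X\<in>E. nF (D X) \<le> K * nE X)"

definition holomorphic_between ::
    "('a::real_normed_vector cplxn \<Rightarrow>\<^sub>L 'a cplxn) set \<Rightarrow> (('a cplxn \<Rightarrow>\<^sub>L 'a cplxn) \<Rightarrow> real) \<Rightarrow>
     ('a cplxn \<Rightarrow>\<^sub>L 'a cplxn) set \<Rightarrow> (('a cplxn \<Rightarrow>\<^sub>L 'a cplxn) \<Rightarrow> real) \<Rightarrow>
     ('a cplxn \<Rightarrow>\<^sub>L 'a cplxn) set \<Rightarrow>
     (('a cplxn \<Rightarrow>\<^sub>L 'a cplxn) \<Rightarrow> ('a cplxn \<Rightarrow>\<^sub>L 'a cplxn)) \<Rightarrow> bool" where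
  "holomorphic_between E nE F nF U f \<longleftrightarrow>
     openin (Metric_space.mtopology E (\<lambda>X Y. nE (X - Y))) U \<and>
     f \<in> U \<rightarrow> F \<and>
     (\<forall>Z\<in>U. \<exists>D. bounded_clinear_between E nE F nF D \<and>
        (\<forall>\<epsilon>>0. \<exists>\<delta>>0. \<forall>Y\<in>U. nE (Y - Z) < \<delta> \<longrightarrow>
           nF (f Y - f Z - D (Y - Z)) \<le> \<epsilon> * nE (Y - Z)))"

end

theory Submission
  imports Defs
begin

text \<open>
  Formally the transition function is a fractional linear map, and it is differentiated as
  such.  Put \<open>A(Z) = a + bZ\<close>, \<open>T(Z) = A(Z)\<^sup>-\<^sup>1\<close>, \<open>f(Z) = (c + dZ) T(Z)\<close> and \<open>X = Y - Z\<close>.  Then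
  \<open>f(Y) - f(Z) = (d - f(Z) b) X T(Y)\<close> holds exactly, so the derivative at \<open>Z\<close> has to be
  \<open>X \<mapsto> (d - f(Z) b) X T(Z)\<close>, and the remainder \<open>(d - f(Z) b) X (T(Y) - T(Z))\<close> is quadratic in
  \<open>X\<close> by the resolvent identity.  Since Hilbert-Schmidt operators form an ideal, with
  \<open>\<parallel>AXB\<parallel>\<^sub>2 \<le> \<parallel>A\<parallel> \<parallel>X\<parallel>\<^sub>2 \<parallel>B\<parallel>\<close>, and their norm dominates the operator norm, these estimates take place
  in the Hilbert-Schmidt norm, and so does the openness of the domain, which is the stability of
  invertibility under small perturbations (lemmas \<open>U_stable\<close> and \<open>quadratic_remainder\<close>).

  It remains to see that \<open>f(Z)\<close> and the derivative lie in the right space.  They are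
  Hilbert-Schmidt because \<open>Z\<close> and \<open>X\<close> are and \<open>c\<close> has finite rank: it is the projection to
  \<open>W\<^sub>2\<^sup>\<bottom>\<close> restricted to \<open>W\<^sub>1\<close>, and it kills all but finitely many of the basis vectors.  The
  condition \<open>\<alpha>Z\<alpha> = -Z\<^sup>*\<close> says that \<open>Z\<close> is skew for the complex bilinear extension of \<open>g\<close>.  Both
  \<open>W\<^sub>S\<close> and \<open>W\<^sub>S\<^sup>\<bottom> = \<alpha>W\<^sub>S\<close> are isotropic for this form, so skewness of \<open>Z\<close> means that its graph is
  isotropic, and \<open>f(Z)\<close> has the same graph as \<open>Z\<close> (lemma \<open>chart_change_in_B2_alpha\<close>).  The form of the
  derivative is the pullback of the form of \<open>X\<close> by \<open>T(Z)\<close> (lemma \<open>derivative_in_B2_alpha\<close>).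

  All the \<open>W\<^sub>S\<close> are spanned by parts of one orthonormal basis \<open>E\<close> of the complexification, namely
  the \<open>e\<^sub>k\<close> together with their conjugates.  Exchanging a basis for another by passing to adjoints and
  using Parseval's identity shows that every Hilbert-Schmidt norm is the square root of the sum of
  \<open>\<parallel>Zv\<parallel>\<^sup>2\<close> over \<open>v \<in> E\<close> (lemma \<open>hs_norm_eq\<close>).
\<close>

section \<open>The complexification\<close>

text \<open>Statements quantified over the complexification are not split into real and imaginary parts.\<close>

declare split_paired_All [simp del]

interpretation cvs: vector_space "cscale :: complex \<Rightarrow> 'a::real_vector cplxn \<Rightarrow> 'a cplxn"
  by (rule vector_space_cscale)

lemma clinear_iff:
  fixes f :: "'a::real_vector cplxn \<Rightarrow> 'a cplxn"
  shows "clinear f \<longleftrightarrow>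
    (\<forall>x y. f (x + y) = f x + f y) \<and> (\<forall>c x. f (cscale c x) = cscale c (f x))"
  using vector_space_cscale by (auto simp: Vector_Spaces.linear_iff)

lemma clinear_add: "clinear f \<Longrightarrow> f (x + y) = f x + f y"
  and clinear_cscale: "clinear f \<Longrightarrow> f (cscale k x) = cscale k (f x)"
  unfolding clinear_iff by blast+

lemma clinear_blinfun_compose:
  fixes A B :: "'a::real_normed_vector cplxn \<Rightarrow>\<^sub>L 'a cplxn"
  assumes "clinear (blinfun_apply A)" "clinear (blinfun_apply B)"
  shows "clinear (blinfun_apply (A o\<^sub>L B))"
  unfolding clinear_iff by (simp add: clinear_add clinear_cscale assms)

lemma bounded_linear_cscale: "bounded_linear (cscale c :: 'a::real_normed_vector cplxn \<Rightarrow> 'a cplxn)"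
  unfolding cscale_def
  by (intro bounded_linear_Pair bounded_linear_sub bounded_linear_add
      bounded_linear_const_scaleR bounded_linear_fst bounded_linear_snd)

lemma cconj_add: "cconj (x + y) = cconj x + cconj y"
  and cconj_diff: "cconj (x - y) = cconj x - cconj y"
  and cconj_cscale: "cconj (cscale k x) = cscale (cnj k) (cconj x)"
  and cconj_cconj [simp]: "cconj (cconj x) = x"
  and cconj_zero [simp]: "cconj 0 = 0"
  by (auto simp: cconj_def cscale_def prod_eq_iff)

lemma bounded_linear_cconj: "bounded_linear (cconj :: 'a::real_normed_vector cplxn \<Rightarrow> 'a cplxn)"
  unfolding cconj_def
  by (intro bounded_linear_Pair bounded_linear_minus bounded_linear_fst bounded_linear_snd)

section \<open>The Hermitian form of a strong inner product\<close>

lemma semidefinite_Cauchy_Schwarz: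
  fixes q :: "'b::real_normed_vector \<Rightarrow> 'b \<Rightarrow> real"
  assumes bilin: "bounded_bilinear q" and sym: "\<And>v w. q v w = q w v" and pos: "\<And>v. 0 \<le> q v v"
  shows "(q v w)\<^sup>2 \<le> q v v * q w w"
proof -
  interpret q: bounded_bilinear q by fact
  have *: "0 \<le> q v v - 2 * t * q v w + t\<^sup>2 * q w w" for t
  proof -
    have "q (v - t *\<^sub>R w) (v - t *\<^sub>R w) = q v v - 2 * t * q v w + t\<^sup>2 * q w w"
      by (simp add: q.diff_left q.diff_right q.scaleR_left q.scaleR_right sym[of w v]
          power2_eq_square algebra_simps)
    with pos show ?thesis by metis
  qed
  show ?thesis
  proof (cases "q w w = 0")
    case True
    have "q v w = 0"
    proof (rule ccontr)
      assume "q v w \<noteq> 0"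
      with *[of "(q v v + 1) / (2 * q v w)"] True show False by simp
    qed
    with True show ?thesis by simp
  next
    case False
    hence "q w w > 0" using pos[of w] by linarith
    with *[of "q v w / q w w"] show ?thesis
      by (simp add: field_simps power2_eq_square)
  qed
qed

text \<open>The given norm need not be the one that \<open>g\<close> defines.  The two are equivalent because \<open>to_dual g\<close>
  is a bounded isomorphism, and this is also what replaces the Riesz representation theorem.\<close>

locale strong_inner =
  fixes g :: "'a::real_normed_vector \<Rightarrow> 'a \<Rightarrow> real"
  assumes strong: "strong_inner_product g"
begin

sublocale g: bounded_bilinear g
  using strong by (simp add: strong_inner_product_def)

abbreviation ip :: "'a cplxn \<Rightarrow> 'a cplxn \<Rightarrow> complex" where "ip \<equiv> g_ext g"
abbreviation N :: "'a cplxn \<Rightarrow> real" where "N \<equiv> g_norm g"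

lemma g_sym: "g v w = g w v"
  using strong by (simp add: strong_inner_product_def)

lemma g_nonneg: "0 \<le> g v v"
  using strong by (simp add: strong_inner_product_def)

lemma to_dual_apply: "blinfun_apply (to_dual g v) w = g v w"
  by (simp add: to_dual_def bounded_linear_Blinfun_apply g.bounded_linear_right)

lemma riesz: "bounded_linear f \<Longrightarrow> \<exists>u. \<forall>x. f x = g x u"
proof -
  assume f: "bounded_linear f"
  have "surj (to_dual g)"
    using strong by (auto simp: strong_inner_product_def bounded_isomorphism_def bij_def)
  then obtain u where u: "to_dual g u = Blinfun f" by (metis surjD)
  have "f x = g x u" for x
    using f u by (metis bounded_linear_Blinfun_apply g_sym to_dual_apply)
  thus ?thesis by blast
qed

text \<open>The functional \<open>g(v, \<cdot>)\<close> has norm at most a multiple of \<open>sqrt (g v v)\<close> by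
  Cauchy-Schwarz, and \<open>v\<close> is recovered from this functional by a bounded map.\<close>

lemma norm_le_sqrt_g: "\<exists>k>0. \<forall>v. norm v \<le> k * sqrt (g v v)"
proof -
  obtain B where B: "0 < B" "\<And>v w. norm (g v w) \<le> norm v * norm w * B"
    using g.pos_bounded by blast
  have iso: "bij (to_dual g)" "bounded_linear (inv (to_dual g))"
    using strong by (auto simp: strong_inner_product_def bounded_isomorphism_def)
  obtain K where K: "0 < K" "\<And>f. norm (inv (to_dual g) f) \<le> norm f * K"
    using bounded_linear.pos_bounded[OF iso(2)] by blast
  have dual: "norm (to_dual g v) \<le> sqrt (g v v) * sqrt B" for v
  proof (rule norm_blinfun_bound)
    fix w
    have "(g v w)\<^sup>2 \<le> g v v * g w w"
      by (rule semidefinite_Cauchy_Schwarz[OF g.bounded_bilinear_axioms g_sym g_nonneg])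
    hence "\<bar>g v w\<bar> \<le> sqrt (g v v) * sqrt (g w w)"
      by (metis real_sqrt_abs real_sqrt_le_iff real_sqrt_mult)
    also have "sqrt (g w w) \<le> sqrt (B * (norm w)\<^sup>2)"
      using B(2)[of w w] by (intro real_sqrt_le_mono) (auto simp: power2_eq_square mult_ac)
    also have "sqrt (B * (norm w)\<^sup>2) = sqrt B * norm w"
      by (simp add: real_sqrt_mult)
    finally show "norm (blinfun_apply (to_dual g v) w) \<le> sqrt (g v v) * sqrt B * norm w"
      by (simp add: to_dual_apply mult_left_mono g_nonneg mult.assoc)
  qed (use B g_nonneg in simp)
  have "norm v \<le> (sqrt B * K) * sqrt (g v v)" for v
  proof -
    have "norm v = norm (inv (to_dual g) (to_dual g v))"
      using iso(1) by (simp add: bij_is_inj)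
    also have "\<dots> \<le> norm (to_dual g v) * K" by (rule K)
    also have "\<dots> \<le> (sqrt (g v v) * sqrt B) * K"
      using dual K by (intro mult_right_mono) auto
    finally show ?thesis by (simp add: mult_ac)
  qed
  thus ?thesis using B K by (intro exI[of _ "sqrt B * K"]) auto
qed

lemma bounded_bilinear_ip: "bounded_bilinear ip"
proof
  obtain B where B: "0 < B" "\<And>v w. norm (g v w) \<le> norm v * norm w * B"
    using g.pos_bounded by blast
  have est: "\<bar>g v w\<bar> \<le> norm z * norm z' * B" if "norm v \<le> norm z" "norm w \<le> norm z'"
    for v w :: 'a and z z' :: "'a cplxn"
  proof -
    have "\<bar>g v w\<bar> \<le> norm v * norm w * B" using B(2)[of v w] by simp
    also have "\<dots> \<le> norm z * norm z' * B"
      using that B by (intro mult_right_mono mult_mono) auto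
    finally show ?thesis .
  qed
  have comp: "norm (fst z) \<le> norm z" "norm (snd z) \<le> norm z" for z :: "'a cplxn"
    by (metis norm_fst_le prod.collapse, metis norm_snd_le prod.collapse)
  have "norm (ip z w) \<le> norm z * norm w * (4 * B)" for z w
  proof -
    have "norm (ip z w) \<le> \<bar>Re (ip z w)\<bar> + \<bar>Im (ip z w)\<bar>" by (rule cmod_le)
    also have "\<dots> \<le> 4 * (norm z * norm w * B)"
      using est[of "fst z" z "fst w" w] est[of "snd z" z "snd w" w]
        est[of "snd z" z "fst w" w] est[of "fst z" z "snd w" w] comp[of z] comp[of w]
      unfolding g_ext_def complex.sel by linarith
    finally show ?thesis by simp
  qed
  thus "\<exists>K. \<forall>a b. norm (ip a b) \<le> norm a * norm b * K" by blast
qed (auto simp: g_ext_def complex_eq_iff g.add_left g.add_right g.scaleR_left g.scaleR_right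
    algebra_simps)

sublocale ip: bounded_bilinear ip
  by (rule bounded_bilinear_ip)

lemma ip_cscale_left: "ip (cscale k z) w = k * ip z w"
  by (simp add: g_ext_def cscale_def complex_eq_iff g.add_left g.diff_left g.scaleR_left
      algebra_simps)

lemma ip_sym: "ip w z = cnj (ip z w)"
  by (simp add: g_ext_def complex_eq_iff g_sym[of "fst w"] g_sym[of "snd w"])

lemma ip_cscale_right: "ip z (cscale k w) = cnj k * ip z w"
  by (metis ip_cscale_left ip_sym complex_cnj_mult)

lemma ip_cconj: "ip (cconj z) (cconj w) = cnj (ip z w)"
  by (simp add: g_ext_def cconj_def complex_eq_iff g.minus_left g.minus_right)

lemma Re_ip_self_nonneg: "0 \<le> Re (ip z z)"
  by (simp add: g_ext_def g_nonneg)

lemma N_nonneg [simp]: "0 \<le> N z"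
  by (simp add: g_norm_def Re_ip_self_nonneg)

lemma N_square: "(N z)\<^sup>2 = Re (ip z z)"
  by (simp add: g_norm_def Re_ip_self_nonneg)

lemma ip_self: "ip z z = of_real ((N z)\<^sup>2)"
  unfolding N_square by (simp add: complex_eq_iff g_ext_def g_sym[of "snd z" "fst z"])

lemma N_cscale: "N (cscale k z) = cmod k * N z"
proof -
  have "(N (cscale k z))\<^sup>2 = (cmod k * N z)\<^sup>2"
  proof -
    have "ip (cscale k z) (cscale k z) = (k * cnj k) * ip z z"
      by (simp add: ip_cscale_left ip_cscale_right)
    also have "\<dots> = of_real ((cmod k * N z)\<^sup>2)"
      by (simp add: ip_self complex_norm_square[symmetric] power_mult_distrib)
    finally show ?thesis by (metis N_square Re_complex_of_real)
  qed
  thus ?thesis by (simp add: power2_eq_iff_nonneg)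
qed

lemma bounded_bilinear_Re_ip: "bounded_bilinear (\<lambda>z w. Re (ip z w))"
proof
  obtain K where "\<And>z w. norm (ip z w) \<le> norm z * norm w * K"
    using ip.bounded by blast
  thus "\<exists>K. \<forall>z w. norm (Re (ip z w)) \<le> norm z * norm w * K"
    by (metis abs_Re_le_cmod order_trans real_norm_def)
qed (simp_all add: ip.add_left ip.add_right ip.scaleR_left ip.scaleR_right)

lemma Re_ip_sym: "Re (ip w z) = Re (ip z w)"
  by (subst ip_sym) simp

lemma Re_ip_le: "Re (ip z w) \<le> N z * N w"
proof -
  have "(Re (ip z w))\<^sup>2 \<le> Re (ip z z) * Re (ip w w)"
    by (rule semidefinite_Cauchy_Schwarz[OF bounded_bilinear_Re_ip Re_ip_sym Re_ip_self_nonneg])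
  hence "(Re (ip z w))\<^sup>2 \<le> (N z * N w)\<^sup>2"
    by (simp add: N_square power_mult_distrib)
  thus ?thesis by (rule power2_le_imp_le) simp
qed

lemma N_triangle: "N (z + w) \<le> N z + N w"
proof (rule power2_le_imp_le)
  show "(N (z + w))\<^sup>2 \<le> (N z + N w)\<^sup>2"
    using Re_ip_le[of z w] Re_ip_sym[of w z]
    by (simp add: N_square power2_sum ip.add_left ip.add_right)
qed simp

lemma ip_Cauchy_Schwarz: "cmod (ip z w) \<le> N z * N w"
proof -
  \<comment> \<open>A phase makes the product real, which reduces the claim to its real part.\<close>
  obtain k where k: "cmod k = 1" "k * ip z w = of_real (cmod (ip z w))"
  proof (cases "ip z w = 0")
    case False
    show ?thesis
      by (rule that[of "cnj (ip z w) / of_real (cmod (ip z w))"])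
         (use False in \<open>auto simp: norm_divide power2_eq_square mult.commute[of "cnj _"]
            complex_norm_square[symmetric]\<close>)
  qed (use that[of 1] in auto)
  have "cmod (ip z w) = Re (ip (cscale k z) w)"
    by (simp add: ip_cscale_left k)
  also have "\<dots> \<le> N (cscale k z) * N w" by (rule Re_ip_le)
  finally show ?thesis by (simp add: N_cscale k)
qed

lemma N_equivalent: "\<exists>k>0. \<forall>z. norm z \<le> k * N z \<and> N z \<le> k * norm z"
proof -
  obtain k where k: "k > 0" "\<And>v. norm v \<le> k * sqrt (g v v)" using norm_le_sqrt_g by blast
  obtain B where B: "0 < B" "\<And>z w. norm (ip z w) \<le> norm z * norm w * B"
    using ip.pos_bounded by blast
  have 1: "norm z \<le> k * N z" for z
  proof -
    have "norm z = sqrt ((norm (fst z))\<^sup>2 + (norm (snd z))\<^sup>2)" by (simp add: norm_prod_def)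
    also have "\<dots> \<le> sqrt ((k * sqrt (g (fst z) (fst z)))\<^sup>2 + (k * sqrt (g (snd z) (snd z)))\<^sup>2)"
      by (intro real_sqrt_le_mono add_mono power_mono k) auto
    also have "\<dots> = sqrt (k\<^sup>2 * Re (ip z z))"
      by (simp add: g_ext_def power_mult_distrib g_nonneg algebra_simps)
    also have "\<dots> = k * N z" using k by (simp add: g_norm_def real_sqrt_mult)
    finally show ?thesis .
  qed
  have 2: "N z \<le> sqrt B * norm z" for z
  proof -
    have "Re (ip z z) \<le> B * (norm z)\<^sup>2"
      using B(2)[of z z] complex_Re_le_cmod[of "ip z z"] by (simp add: power2_eq_square mult_ac)
    hence "N z \<le> sqrt (B * (norm z)\<^sup>2)" unfolding g_norm_def by (rule real_sqrt_le_mono)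
    thus ?thesis by (simp add: real_sqrt_mult)
  qed
  have "norm z \<le> max k (sqrt B) * N z \<and> N z \<le> max k (sqrt B) * norm z" for z
    using 1[of z] 2[of z]
    by (meson max.cobounded1 max.cobounded2 mult_right_mono N_nonneg norm_ge_zero order_trans)
  thus ?thesis using k by (intro exI[of _ "max k (sqrt B)"]) auto
qed

text \<open>One constant for both directions, since the operator norms in the estimates below refer to the
  given norm of the space and the Hilbert-Schmidt norms to \<open>g\<close>.\<close>

definition \<kappa> :: real where
  "\<kappa> = (SOME k. k > 0 \<and> (\<forall>z. norm z \<le> k * N z \<and> N z \<le> k * norm z))"

lemma \<kappa>_pos: "\<kappa> > 0" and norm_le_N: "norm z \<le> \<kappa> * N z" and N_le_norm: "N z \<le> \<kappa> * norm z"
  using someI_ex[OF N_equivalent[unfolded Bex_def]] unfolding \<kappa>_def by blast+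

lemma N_zero [simp]: "N 0 = 0"
  by (simp add: g_norm_def ip.zero_left)

lemma N_eq_0_iff [simp]: "N z = 0 \<longleftrightarrow> z = 0"
  using norm_le_N[of z] by (auto simp: g_norm_def ip.zero_left)

lemma ip_self_eq_0_iff: "ip z z = 0 \<longleftrightarrow> z = 0"
  by (simp add: ip_self)

lemma ip_right_unique: "(\<And>v. ip v x = ip v y) \<Longrightarrow> x = y"
  by (metis ip.diff_right ip_self_eq_0_iff right_minus_eq)

section \<open>Adjoints\<close>

text \<open>Riesz representation of the real part of \<open>\<langle>Tv, w\<rangle>\<close>, separately on each real summand.\<close>

lemma adjoint_operator:
  fixes T :: "'a cplxn \<Rightarrow>\<^sub>L 'a cplxn"
  assumes lin: "clinear (blinfun_apply T)"
  shows "ip (T v) w = ip v (adjoint_operator g T w)"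
proof -
  have "\<exists>u. \<forall>v. ip (T v) w = ip v u" for w
  proof -
    have bl: "bounded_linear (\<lambda>v. Re (ip (T v) w))"
      by (intro bounded_linear_compose[OF bounded_linear_Re]
          bounded_linear_compose[OF ip.bounded_linear_left] blinfun.bounded_linear_right)
    obtain u1 where u1: "\<And>x. Re (ip (T (x, 0)) w) = g x u1"
      using riesz[OF bounded_linear_compose[OF bl bounded_linear_Pair[OF bounded_linear_ident bounded_linear_zero]]]
      by auto
    obtain u2 where u2: "\<And>x. Re (ip (T (0, x)) w) = g x u2"
      using riesz[OF bounded_linear_compose[OF bl bounded_linear_Pair[OF bounded_linear_zero bounded_linear_ident]]]
      by auto
    have re: "Re (ip (T v) w) = Re (ip v (u1, u2))" for v
    proof -
      have "v = (fst v, 0) + (0, snd v)" by simp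
      hence "Re (ip (T v) w) = Re (ip (T (fst v, 0)) w) + Re (ip (T (0, snd v)) w)"
        by (metis blinfun.add_right ip.add_left plus_complex.sel(1))
      thus ?thesis unfolding u1 u2 by (simp add: g_ext_def)
    qed
    \<comment> \<open>The imaginary part is the real part at \<open>-iv\<close>.\<close>
    have im: "Im (ip (T v) w) = Im (ip v (u1, u2))" for v
      using re[of "cscale (- \<i>) v"] unfolding clinear_cscale[OF lin] ip_cscale_left by simp
    show ?thesis using re im by (intro exI[of _ "(u1, u2)"]) (simp add: complex_eq_iff)
  qed
  hence "\<exists>T'. \<forall>v w. ip (T v) w = ip v (T' w)" by metis
  from someI_ex[OF this] show ?thesis unfolding adjoint_operator_def by blast
qed

lemma N_blinfun: "N (blinfun_apply A v) \<le> (\<kappa>\<^sup>2 * norm A) * N v"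
proof -
  have "N (A v) \<le> \<kappa> * norm (A v)" by (rule N_le_norm)
  also have "\<dots> \<le> \<kappa> * (norm A * norm v)"
    using \<kappa>_pos by (intro mult_left_mono norm_blinfun) auto
  also have "\<dots> \<le> \<kappa> * (norm A * (\<kappa> * N v))"
    using \<kappa>_pos by (intro mult_left_mono norm_le_N) auto
  finally show ?thesis by (simp add: power2_eq_square mult_ac)
qed

lemma N_adjoint:
  assumes "clinear (blinfun_apply A)"
  shows "N (adjoint_operator g A w) \<le> (\<kappa>\<^sup>2 * norm A) * N w"
proof -
  let ?u = "adjoint_operator g A w"
  have "(N ?u)\<^sup>2 = Re (ip (A ?u) w)" by (simp add: N_square adjoint_operator[OF assms])
  also have "\<dots> \<le> cmod (ip (A ?u) w)" by (rule complex_Re_le_cmod)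
  also have "\<dots> \<le> N (A ?u) * N w" by (rule ip_Cauchy_Schwarz)
  also have "\<dots> \<le> (\<kappa>\<^sup>2 * norm A) * N ?u * N w"
    by (intro mult_right_mono N_blinfun) auto
  finally have "N ?u * N ?u \<le> N ?u * ((\<kappa>\<^sup>2 * norm A) * N w)"
    by (simp add: power2_eq_square mult_ac)
  thus ?thesis by (cases "N ?u = 0") (auto simp: order_less_le)
qed

end

section \<open>Orthonormal systems\<close>

context strong_inner
begin

definition orthonormal :: "'a cplxn set \<Rightarrow> bool" where
  "orthonormal B \<longleftrightarrow> (\<forall>u\<in>B. \<forall>v\<in>B. ip u v = (if u = v then 1 else 0))"

lemma orthonormal_basis_iff: "orthonormal_basis g W B \<longleftrightarrow> orthonormal B \<and> closure (cspan B) = W"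
  by (simp add: orthonormal_basis_def orthonormal_def)

lemma orthonormal_subset: "orthonormal B \<Longrightarrow> F \<subseteq> B \<Longrightarrow> orthonormal F"
  unfolding orthonormal_def by blast

lemma N_diff_unit:
  assumes "ip x x = 1"
  shows "(N (z - cscale r x))\<^sup>2 = (N z)\<^sup>2 - (cmod (ip z x))\<^sup>2 + (cmod (ip z x - r))\<^sup>2"
proof -
  have "ip (z - cscale r x) (z - cscale r x) = ip z z - cnj r * ip z x - r * cnj (ip z x) + r * cnj r"
    using assms ip_sym[of x z]
    by (simp add: ip.diff_left ip.diff_right ip_cscale_left ip_cscale_right algebra_simps)
  hence "Re (ip (z - cscale r x) (z - cscale r x)) =
    Re (ip z z - cnj r * ip z x - r * cnj (ip z x) + r * cnj r)" by simp
  thus ?thesis unfolding N_square cmod_power2 by (simp add: power2_eq_square algebra_simps)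
qed

text \<open>Completing the square.  The choice \<open>r\<^sub>b = \<langle>z, b\<rangle>\<close> gives Bessel's inequality, and a comparison
  of the two sides shows that this choice is the best approximation.\<close>

lemma N_diff_sum:
  assumes "finite F" "orthonormal F"
  shows "(N (z - (\<Sum>b\<in>F. cscale (r b) b)))\<^sup>2 =
    (N z)\<^sup>2 - (\<Sum>b\<in>F. (cmod (ip z b))\<^sup>2) + (\<Sum>b\<in>F. (cmod (ip z b - r b))\<^sup>2)"
  using assms
proof (induction F)
  case (insert x F)
  let ?z = "z - (\<Sum>b\<in>F. cscale (r b) b)"
  have IH: "(N ?z)\<^sup>2 = (N z)\<^sup>2 - (\<Sum>b\<in>F. (cmod (ip z b))\<^sup>2) + (\<Sum>b\<in>F. (cmod (ip z b - r b))\<^sup>2)"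
    using insert orthonormal_subset[of "insert x F" F] by blast
  have x: "ip x x = 1" and orth: "\<And>b. b \<in> F \<Longrightarrow> ip b x = 0"
    using insert by (auto simp: orthonormal_def)
  have "ip ?z x = ip z x"
    using orth by (simp add: ip.diff_left ip.sum_left ip_cscale_left)
  hence step: "(N (?z - cscale (r x) x))\<^sup>2 = (N ?z)\<^sup>2 - (cmod (ip z x))\<^sup>2 + (cmod (ip z x - r x))\<^sup>2"
    using N_diff_unit[OF x, of ?z "r x"] by simp
  have split: "z - (\<Sum>b\<in>insert x F. cscale (r b) b) = ?z - cscale (r x) x"
    using insert by (simp add: algebra_simps)
  show ?case unfolding split step IH using insert.hyps by simp
qed simp

lemma Bessel:
  assumes "orthonormal B" "finite F" "F \<subseteq> B"
  shows "(\<Sum>b\<in>F. (cmod (ip z b))\<^sup>2) \<le> (N z)\<^sup>2"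
  using N_diff_sum[OF assms(2) orthonormal_subset[OF assms(1,3)], of z "ip z"]
    zero_le_power2[of "N (z - (\<Sum>b\<in>F. cscale (ip z b) b))"]
  by simp

lemma best_approximation:
  assumes "orthonormal B" "z \<in> closure (cspan B)" "\<epsilon> > 0"
  obtains F where "finite F" "F \<subseteq> B" "(N (z - (\<Sum>b\<in>F. cscale (ip z b) b)))\<^sup>2 < \<epsilon>"
proof -
  define \<delta> where "\<delta> = sqrt \<epsilon> / \<kappa>"
  have "\<delta> > 0" using assms \<kappa>_pos by (simp add: \<delta>_def)
  then obtain y where y: "y \<in> cspan B" "dist y z < \<delta>"
    using assms(2) by (auto simp: closure_approachable)
  obtain F r where F: "finite F" "F \<subseteq> B" "y = (\<Sum>b\<in>F. cscale (r b) b)"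
    using y(1) unfolding cvs.span_explicit by blast
  have orth: "orthonormal F" using assms(1) F(2) by (rule orthonormal_subset)
  have "N (z - y) \<le> \<kappa> * norm (z - y)" by (rule N_le_norm)
  also have "\<dots> < \<kappa> * \<delta>"
    using y(2) \<kappa>_pos by (simp add: dist_norm norm_minus_commute)
  also have "\<dots> = sqrt \<epsilon>" using \<kappa>_pos by (simp add: \<delta>_def)
  finally have "(N (z - y))\<^sup>2 < (sqrt \<epsilon>)\<^sup>2" by (intro power_strict_mono) auto
  hence "(N (z - y))\<^sup>2 < \<epsilon>" using assms(3) by simp
  moreover have "(N (z - (\<Sum>b\<in>F. cscale (ip z b) b)))\<^sup>2 \<le> (N (z - y))\<^sup>2"
    using N_diff_sum[OF F(1) orth, of z r] N_diff_sum[OF F(1) orth, of z "ip z"]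
    by (simp add: F(3) sum_nonneg)
  ultimately show ?thesis by (intro that[OF F(1,2)]) linarith
qed

theorem Parseval:
  assumes "orthonormal B" "z \<in> closure (cspan B)"
  shows "((\<lambda>b. (cmod (ip z b))\<^sup>2) has_sum (N z)\<^sup>2) B"
proof -
  let ?f = "\<lambda>b. (cmod (ip z b))\<^sup>2"
  have bound: "sum ?f F \<le> (N z)\<^sup>2" if "finite F" "F \<subseteq> B" for F
    using Bessel[OF assms(1) that] .
  have summable: "?f summable_on B"
    by (rule nonneg_bdd_above_summable_on) (auto intro!: bdd_aboveI2[where M = "(N z)\<^sup>2"] bound)
  have "infsum ?f B = (N z)\<^sup>2"
  proof (rule antisym)
    show "infsum ?f B \<le> (N z)\<^sup>2" by (rule infsum_le_finite_sums[OF summable bound])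
    show "(N z)\<^sup>2 \<le> infsum ?f B"
    proof (rule field_le_epsilon)
      fix \<epsilon> :: real assume "\<epsilon> > 0"
      then obtain F where F: "finite F" "F \<subseteq> B" "(N (z - (\<Sum>b\<in>F. cscale (ip z b) b)))\<^sup>2 < \<epsilon>"
        using best_approximation[OF assms] by blast
      have "(N z)\<^sup>2 - sum ?f F < \<epsilon>"
        using F(3) N_diff_sum[OF F(1) orthonormal_subset[OF assms(1) F(2)], of z "ip z"] by simp
      moreover have "sum ?f F \<le> infsum ?f B"
        by (rule finite_sum_le_infsum[OF summable F(1,2)]) simp
      ultimately show "(N z)\<^sup>2 \<le> infsum ?f B + \<epsilon>" by linarith
    qed
  qed
  with has_sum_infsum[OF summable] show ?thesis by simp
qed

lemma subspace_perp: "cvs.subspace (perp g X)"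
  by (auto simp: cvs.subspace_def perp_def ip.zero_left ip.add_left ip_cscale_left)

lemma closed_perp: "closed (perp g X)"
proof -
  have "perp g X = (\<Inter>w\<in>X. {z. ip z w = 0})" by (auto simp: perp_def)
  moreover have "closed {z. ip z w = 0}" for w
    by (intro closed_Collect_eq continuous_on_const linear_continuous_on ip.bounded_linear_left)
  ultimately show ?thesis by auto
qed

lemma closure_cspan_subset_perp: "B \<subseteq> perp g X \<Longrightarrow> closure (cspan B) \<subseteq> perp g X"
  by (intro closure_minimal closed_perp cvs.span_minimal subspace_perp)

lemma perp_swap: "A \<subseteq> perp g B \<longleftrightarrow> B \<subseteq> perp g A"
proof -
  have "ip z w = 0 \<longleftrightarrow> ip w z = 0" for z w by (metis ip_sym complex_cnj_zero)
  thus ?thesis unfolding perp_def subset_iff mem_Collect_eq by metis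
qed

lemma perp_closure_cspan: "perp g (closure (cspan B)) = perp g B"
proof
  show "perp g (closure (cspan B)) \<subseteq> perp g B"
    using closure_subset[of "cspan B"] cvs.span_superset[of B] by (auto simp: perp_def)
  show "perp g B \<subseteq> perp g (closure (cspan B))"
    using perp_swap[of "perp g B" B] closure_cspan_subset_perp[of B "perp g B"]
      perp_swap[of "perp g B" "closure (cspan B)"] by blast
qed

end

text \<open>An orthonormal basis \<open>E\<close> of the whole complexification.  The subspaces that occur below are
  spanned by subsets of \<open>E\<close>.\<close>

locale orthonormal_frame = strong_inner g
  for g :: "'a::{real_normed_vector, complete_space} \<Rightarrow> 'a \<Rightarrow> real" +
  fixes E :: "'a cplxn set"
  assumes frame: "orthonormal_basis g UNIV E"
begin

lemma orthonormal_E: "orthonormal E" and closure_E: "closure (cspan E) = UNIV"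
  using frame by (auto simp: orthonormal_basis_iff)

definition coord :: "'a cplxn set \<Rightarrow> 'a cplxn set" where
  "coord B = closure (cspan B)"

lemma orthonormal_basis_coord: "B \<subseteq> E \<Longrightarrow> orthonormal_basis g (coord B) B"
  by (simp add: orthonormal_basis_iff coord_def orthonormal_subset[OF orthonormal_E])

text \<open>A vector orthogonal to \<open>E - B\<close> is approximated by its own Fourier sums, and these only involve
  elements of \<open>B\<close>.\<close>

lemma coord_eq_perp:
  assumes "B \<subseteq> E"
  shows "coord B = perp g (E - B)"
proof
  have "B \<subseteq> perp g (E - B)"
    using assms orthonormal_E by (auto simp: perp_def orthonormal_def)
  thus "coord B \<subseteq> perp g (E - B)"
    unfolding coord_def by (rule closure_cspan_subset_perp)
  show "perp g (E - B) \<subseteq> coord B"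
  proof
    fix z assume z: "z \<in> perp g (E - B)"
    show "z \<in> coord B"
      unfolding coord_def closure_approachable
    proof (intro allI impI)
      fix \<epsilon> :: real assume \<epsilon>: "\<epsilon> > 0"
      have "(\<epsilon> / \<kappa>)\<^sup>2 > 0" using \<epsilon> \<kappa>_pos by simp
      then obtain F where F: "finite F" "F \<subseteq> E"
          "(N (z - (\<Sum>b\<in>F. cscale (ip z b) b)))\<^sup>2 < (\<epsilon> / \<kappa>)\<^sup>2"
        using best_approximation[OF orthonormal_E, of z] closure_E by blast
      let ?s = "\<Sum>b\<in>F. cscale (ip z b) b"
      have "cscale (ip z b) b \<in> cspan B" if "b \<in> F" for b
      proof (cases "b \<in> B")
        case False
        hence "ip z b = 0" using that F(2) z by (auto simp: perp_def)
        thus ?thesis by (simp add: cvs.span_zero)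
      qed (simp add: cvs.span_base cvs.span_scale)
      hence s: "?s \<in> cspan B" by (rule cvs.span_sum)
      have "N (z - ?s) < \<epsilon> / \<kappa>"
        using F(3) \<epsilon> \<kappa>_pos by (intro power2_less_imp_less[of _ "\<epsilon> / \<kappa>"]) auto
      hence "\<kappa> * N (z - ?s) < \<epsilon>" using \<kappa>_pos by (simp add: field_simps)
      hence "norm (z - ?s) < \<epsilon>" using norm_le_N[of "z - ?s"] by simp
      thus "\<exists>y\<in>cspan B. dist y z < \<epsilon>"
        using s by (auto simp: dist_norm norm_minus_commute)
    qed
  qed
qed

lemma perp_coord:
  assumes "B \<subseteq> E"
  shows "perp g (coord B) = coord (E - B)"
proof -
  have "E - (E - B) = B" using assms by blast
  thus ?thesis using coord_eq_perp[of "E - B"] by (simp add: coord_def perp_closure_cspan)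
qed

lemma ip_coord:
  assumes "B \<subseteq> E" "p \<in> coord B" "q \<in> coord (E - B)"
  shows "ip p q = 0" "ip q p = 0"
proof -
  show "ip q p = 0" using assms perp_coord[OF assms(1)] by (auto simp: perp_def)
  thus "ip p q = 0" by (metis ip_sym complex_cnj_zero)
qed

lemma subspace_coord: "B \<subseteq> E \<Longrightarrow> cvs.subspace (coord B)"
  by (simp add: coord_eq_perp subspace_perp)

text \<open>The splitting of the algebraic span is contractive, so it extends to the closure by
  completeness.\<close>

lemma coord_decomposition:
  assumes B: "B \<subseteq> E"
  obtains p q where "p \<in> coord B" "q \<in> coord (E - B)" "z = p + q"
proof -
  have "z \<in> closure (cspan E)" by (simp add: closure_E)
  then obtain x where x: "\<And>n. x n \<in> cspan E" "x \<longlonglongrightarrow> z"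
    unfolding closure_sequential by blast
  have "E = B \<union> (E - B)" using B by blast
  hence "\<exists>p q. p \<in> cspan B \<and> q \<in> cspan (E - B) \<and> x n = p + q" for n
    using x(1)[of n] cvs.span_Un[of B "E - B"] by auto
  then obtain p q where pq: "\<And>n. p n \<in> cspan B" "\<And>n. q n \<in> cspan (E - B)" "\<And>n. x n = p n + q n"
    by metis
  have contr: "dist (p m) (p n) \<le> \<kappa>\<^sup>2 * dist (x m) (x n)" for m n
  proof -
    let ?p = "p m - p n" and ?q = "q m - q n"
    have "?p \<in> cspan B" "?q \<in> cspan (E - B)" using pq by (auto intro: cvs.span_diff)
    hence "?p \<in> coord B" "?q \<in> coord (E - B)"
      unfolding coord_def using closure_subset by blast+
    hence "ip ?p ?q = 0" "ip ?q ?p = 0" using ip_coord[OF B] by blast+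
    hence "(N (?p + ?q))\<^sup>2 = (N ?p)\<^sup>2 + (N ?q)\<^sup>2"
      unfolding N_square ip.add_left ip.add_right by simp
    hence "(N ?p)\<^sup>2 \<le> (N (?p + ?q))\<^sup>2" by simp
    hence "N ?p \<le> N (?p + ?q)" by (rule power2_le_imp_le) simp
    also have "?p + ?q = x m - x n" by (simp add: pq)
    finally have *: "N ?p \<le> N (x m - x n)" .
    have "norm ?p \<le> \<kappa> * N ?p" by (rule norm_le_N)
    also have "\<dots> \<le> \<kappa> * (\<kappa> * norm (x m - x n))"
      using \<kappa>_pos * N_le_norm[of "x m - x n"] by (intro mult_left_mono) auto
    finally show ?thesis by (simp add: dist_norm power2_eq_square)
  qed
  have "Cauchy p"
  proof (rule metric_CauchyI)
    fix \<epsilon> :: real assume \<epsilon>: "\<epsilon> > 0"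
    have "Cauchy x" using x(2) by (rule LIMSEQ_imp_Cauchy)
    then obtain M where M: "\<And>m n. m \<ge> M \<Longrightarrow> n \<ge> M \<Longrightarrow> dist (x m) (x n) < \<epsilon> / \<kappa>\<^sup>2"
      using \<epsilon> \<kappa>_pos unfolding Cauchy_def by (meson divide_pos_pos zero_less_power)
    have "dist (p m) (p n) < \<epsilon>" if "m \<ge> M" "n \<ge> M" for m n
    proof -
      have "\<kappa>\<^sup>2 * dist (x m) (x n) < \<epsilon>" using M[OF that] \<kappa>_pos by (simp add: field_simps)
      thus ?thesis using contr[of m n] by simp
    qed
    thus "\<exists>M. \<forall>m\<ge>M. \<forall>n\<ge>M. dist (p m) (p n) < \<epsilon>" by blast
  qed
  then obtain P where P: "p \<longlonglongrightarrow> P"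
    using Cauchy_convergent unfolding convergent_def by blast
  have "q = (\<lambda>n. x n - p n)" by (auto simp: pq)
  hence "q \<longlonglongrightarrow> z - P" using tendsto_diff[OF x(2) P] by simp
  hence "z - P \<in> coord (E - B)" unfolding coord_def closure_sequential using pq by blast
  moreover have "P \<in> coord B" unfolding coord_def closure_sequential using pq P by blast
  ultimately show ?thesis using that[of P "z - P"] by simp
qed

end

section \<open>Hilbert-Schmidt operators\<close>

lemma has_sum_swap_nonneg:
  fixes f :: "'b \<Rightarrow> 'c \<Rightarrow> real"
  assumes nonneg: "\<And>x y. f x y \<ge> 0"
    and rows: "\<And>x. x \<in> A \<Longrightarrow> (f x has_sum r x) B"
    and columns: "\<And>y. y \<in> B \<Longrightarrow> ((\<lambda>x. f x y) has_sum k y) A"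
    and sum: "(r has_sum s) A"
  shows "(k has_sum s) B"
proof -
  let ?F = "\<lambda>(x, y). f x y"
  have "?F summable_on A \<times> B"
    by (rule summable_on_SigmaI[where g = r]) (use rows sum nonneg in \<open>auto simp: summable_on_def\<close>)
  hence "(?F has_sum s) (A \<times> B)"
    by (intro has_sum_SigmaI[where g = r]) (use rows sum in auto)
  hence "((\<lambda>(y, x). f x y) has_sum s) (B \<times> A)"
    by (subst (asm) has_sum_swap) (simp add: case_prod_unfold)
  thus ?thesis by (rule has_sum_SigmaD) (use columns in auto)
qed

context strong_inner
begin

text \<open>Both sums are the double sum of \<open>|\<langle>Tb, c\<rangle>|\<^sup>2\<close>, by Parseval's identity.\<close>

lemma has_sum_adjoint:
  assumes B: "orthonormal_basis g X B" and C: "orthonormal_basis g Y C"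
    and T: "\<And>b. b \<in> B \<Longrightarrow> T b \<in> Y" and T': "\<And>c. c \<in> C \<Longrightarrow> T' c \<in> X"
    and adj: "\<And>b c. ip (T b) c = ip b (T' c)"
    and sum: "((\<lambda>b. (N (T b))\<^sup>2) has_sum s) B"
  shows "((\<lambda>c. (N (T' c))\<^sup>2) has_sum s) C"
proof (rule has_sum_swap_nonneg[OF _ _ _ sum])
  show "((\<lambda>c. (cmod (ip (T b) c))\<^sup>2) has_sum (N (T b))\<^sup>2) C" if "b \<in> B" for b
    using Parseval[of C "T b"] C T[OF that] by (simp add: orthonormal_basis_iff)
  have "cmod (ip (T b) c) = cmod (ip (T' c) b)" for b c
    by (metis adj ip_sym complex_mod_cnj)
  thus "((\<lambda>b. (cmod (ip (T b) c))\<^sup>2) has_sum (N (T' c))\<^sup>2) B" if "c \<in> C" for c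
    using Parseval[of B "T' c"] B T'[OF that] by (simp add: orthonormal_basis_iff)
qed simp

end

context orthonormal_frame
begin

text \<open>These sums run over the basis \<open>E\<close> of the whole space.  For operators that are extended by zero
  from a subspace spanned by part of \<open>E\<close> they give the Hilbert-Schmidt norm, and the subspace no
  longer enters.\<close>

definition square_summable :: "('a cplxn \<Rightarrow> 'a cplxn) \<Rightarrow> bool" where
  "square_summable f \<longleftrightarrow> (\<lambda>v. (N (f v))\<^sup>2) summable_on E"

definition l2norm :: "('a cplxn \<Rightarrow> 'a cplxn) \<Rightarrow> real" where
  "l2norm f = sqrt (\<Sum>\<^sub>\<infinity>v\<in>E. (N (f v))\<^sup>2)"

lemma infsum_squares_nonneg: "0 \<le> (\<Sum>\<^sub>\<infinity>v\<in>E. (N (f v))\<^sup>2)"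
  by (rule infsum_nonneg) simp

lemma l2norm_nonneg [simp]: "0 \<le> l2norm f"
  by (simp add: l2norm_def infsum_squares_nonneg)

lemma has_sum_l2norm: "square_summable f \<Longrightarrow> ((\<lambda>v. (N (f v))\<^sup>2) has_sum (l2norm f)\<^sup>2) E"
  by (simp add: square_summable_def l2norm_def infsum_squares_nonneg has_sum_infsum)

lemma l2normI:
  assumes "((\<lambda>v. (N (f v))\<^sup>2) has_sum s) E"
  shows "square_summable f" "l2norm f = sqrt s"
  using assms by (auto simp: square_summable_def l2norm_def summable_on_def infsumI)

lemma L2_set_le_l2norm:
  assumes "square_summable f" "finite F" "F \<subseteq> E"
  shows "L2_set (\<lambda>v. N (f v)) F \<le> l2norm f"
  unfolding L2_set_def l2norm_def using assms
  by (intro real_sqrt_le_mono finite_sum_le_infsum) (auto simp: square_summable_def)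

lemma l2norm_le:
  assumes "\<And>F. finite F \<Longrightarrow> F \<subseteq> E \<Longrightarrow> L2_set (\<lambda>v. N (f v)) F \<le> M"
  shows "square_summable f" "l2norm f \<le> M"
proof -
  have M: "0 \<le> M" using assms[of "{}"] by simp
  have bound: "(\<Sum>v\<in>F. (N (f v))\<^sup>2) \<le> M\<^sup>2" if "finite F" "F \<subseteq> E" for F
    using assms[OF that] M by (simp add: L2_set_def real_sqrt_le_iff sqrt_le_D)
  show summable: "square_summable f"
    unfolding square_summable_def
    by (rule nonneg_bdd_above_summable_on) (auto intro!: bdd_aboveI2[where M = "M\<^sup>2"] bound)
  have "(\<Sum>\<^sub>\<infinity>v\<in>E. (N (f v))\<^sup>2) \<le> M\<^sup>2"
    using summable bound unfolding square_summable_def by (rule infsum_le_finite_sums)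
  thus "l2norm f \<le> M" unfolding l2norm_def using M by (simp add: real_le_lsqrt infsum_squares_nonneg)
qed

lemma
  assumes "square_summable f" "square_summable h"
  shows square_summable_add: "square_summable (\<lambda>v. f v + h v)"
    and l2norm_triangle: "l2norm (\<lambda>v. f v + h v) \<le> l2norm f + l2norm h"
proof -
  have "L2_set (\<lambda>v. N (f v + h v)) F \<le> l2norm f + l2norm h" if "finite F" "F \<subseteq> E" for F
  proof -
    have "L2_set (\<lambda>v. N (f v + h v)) F \<le> L2_set (\<lambda>v. N (f v) + N (h v)) F"
      by (intro L2_set_mono N_triangle N_nonneg)
    also have "\<dots> \<le> L2_set (\<lambda>v. N (f v)) F + L2_set (\<lambda>v. N (h v)) F"
      by (rule L2_set_triangle_ineq)
    also have "\<dots> \<le> l2norm f + l2norm h"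
      using assms that by (intro add_mono L2_set_le_l2norm)
    finally show ?thesis .
  qed
  from l2norm_le[OF this]
  show "square_summable (\<lambda>v. f v + h v)" "l2norm (\<lambda>v. f v + h v) \<le> l2norm f + l2norm h"
    by simp_all
qed

lemma
  assumes "square_summable f" "0 \<le> K" "\<And>v. v \<in> E \<Longrightarrow> N (h v) \<le> K * N (f v)"
  shows square_summable_dominated: "square_summable h"
    and l2norm_dominated: "l2norm h \<le> K * l2norm f"
proof -
  have "L2_set (\<lambda>v. N (h v)) F \<le> K * l2norm f" if "finite F" "F \<subseteq> E" for F
  proof -
    have "L2_set (\<lambda>v. N (h v)) F \<le> L2_set (\<lambda>v. K * N (f v)) F"
      using assms that by (intro L2_set_mono) auto
    also have "\<dots> = K * L2_set (\<lambda>v. N (f v)) F" using assms by (simp add: L2_set_right_distrib)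
    also have "\<dots> \<le> K * l2norm f"
      using assms that by (intro mult_left_mono L2_set_le_l2norm)
    finally show ?thesis .
  qed
  from l2norm_le[OF this] show "square_summable h" "l2norm h \<le> K * l2norm f" by simp_all
qed

lemma
  assumes Z: "clinear (blinfun_apply Z)" "square_summable (blinfun_apply Z)"
  shows square_summable_adjoint: "square_summable (adjoint_operator g Z)"
    and l2norm_adjoint: "l2norm (adjoint_operator g Z) = l2norm (blinfun_apply Z)"
proof -
  have "((\<lambda>c. (N (adjoint_operator g Z c))\<^sup>2) has_sum (l2norm (blinfun_apply Z))\<^sup>2) E"
    using Z by (intro has_sum_adjoint[OF frame frame _ _ adjoint_operator has_sum_l2norm]) auto
  from l2normI[OF this] show "square_summable (adjoint_operator g Z)"
    "l2norm (adjoint_operator g Z) = l2norm (blinfun_apply Z)" by simp_all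
qed

lemma square_summable_if_adjoint:
  assumes Z: "clinear (blinfun_apply Z)"
    and sum: "((\<lambda>v. (N (adjoint_operator g Z v))\<^sup>2) has_sum s) E"
  shows "((\<lambda>v. (N (Z v))\<^sup>2) has_sum s) E"
proof (rule has_sum_adjoint[OF frame frame _ _ _ sum])
  show "ip (adjoint_operator g Z b) c = ip b (Z c)" for b c
    by (metis adjoint_operator[OF Z] ip_sym)
qed auto

text \<open>\<open>\<parallel>Zv\<parallel>\<^sup>2\<close> is the sum of \<open>|\<langle>v, Z\<^sup>*c\<rangle>|\<^sup>2\<close> over the basis, and the Hilbert-Schmidt norm of
  \<open>Z\<^sup>*\<close> is that of \<open>Z\<close>.\<close>

lemma N_le_l2norm:
  assumes Z: "clinear (blinfun_apply Z)" "square_summable (blinfun_apply Z)"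
  shows "N (Z v) \<le> l2norm (blinfun_apply Z) * N v"
proof -
  let ?Z' = "adjoint_operator g Z"
  have "((\<lambda>c. (cmod (ip (Z v) c))\<^sup>2) has_sum (N (Z v))\<^sup>2) E"
    using Parseval[OF orthonormal_E, of "Z v"] closure_E by simp
  moreover have "((\<lambda>c. (N v)\<^sup>2 * (N (?Z' c))\<^sup>2) has_sum (N v)\<^sup>2 * (l2norm (blinfun_apply Z))\<^sup>2) E"
    using has_sum_l2norm[OF square_summable_adjoint[OF Z]] l2norm_adjoint[OF Z]
    by (intro has_sum_cmult_right) simp
  moreover have "(cmod (ip (Z v) c))\<^sup>2 \<le> (N v)\<^sup>2 * (N (?Z' c))\<^sup>2" for c
    using ip_Cauchy_Schwarz[of v "?Z' c"] unfolding power_mult_distrib[symmetric]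
    by (intro power_mono) (simp_all add: adjoint_operator[OF Z(1)])
  ultimately have "(N (Z v))\<^sup>2 \<le> (N v)\<^sup>2 * (l2norm (blinfun_apply Z))\<^sup>2"
    by (rule has_sum_mono)
  thus ?thesis
    unfolding power_mult_distrib[symmetric] by (simp add: mult.commute power2_le_iff_abs_le)
qed

lemma norm_le_l2norm:
  assumes "clinear (blinfun_apply Z)" "square_summable (blinfun_apply Z)"
  shows "norm Z \<le> \<kappa>\<^sup>2 * l2norm (blinfun_apply Z)"
proof (rule norm_blinfun_bound)
  fix v
  have "norm (Z v) \<le> \<kappa> * N (Z v)" by (rule norm_le_N)
  also have "\<dots> \<le> \<kappa> * (l2norm (blinfun_apply Z) * N v)"
    using \<kappa>_pos by (intro mult_left_mono N_le_l2norm[OF assms]) auto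
  also have "\<dots> \<le> \<kappa> * (l2norm (blinfun_apply Z) * (\<kappa> * norm v))"
    using \<kappa>_pos by (intro mult_left_mono N_le_norm) auto
  finally show "norm (Z v) \<le> \<kappa>\<^sup>2 * l2norm (blinfun_apply Z) * norm v"
    by (simp add: power2_eq_square mult_ac)
qed simp

lemma
  assumes "square_summable (blinfun_apply Z)"
  shows square_summable_compose_left: "square_summable (blinfun_apply (A o\<^sub>L Z))"
    and l2norm_compose_left: "l2norm (blinfun_apply (A o\<^sub>L Z)) \<le> (\<kappa>\<^sup>2 * norm A) * l2norm (blinfun_apply Z)"
  using square_summable_dominated[OF assms, of "\<kappa>\<^sup>2 * norm A"]
    l2norm_dominated[OF assms, of "\<kappa>\<^sup>2 * norm A"] N_blinfun[of A]
  by auto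

text \<open>Composition on the right is composition of the adjoint with \<open>A\<^sup>*\<close> on the left.\<close>

lemma
  assumes Z: "clinear (blinfun_apply Z)" "square_summable (blinfun_apply Z)"
    and A: "clinear (blinfun_apply A)"
  shows square_summable_compose_right: "square_summable (blinfun_apply (Z o\<^sub>L A))"
    and l2norm_compose_right:
      "l2norm (blinfun_apply (Z o\<^sub>L A)) \<le> (\<kappa>\<^sup>2 * norm A) * l2norm (blinfun_apply Z)"
proof -
  let ?h = "\<lambda>v. adjoint_operator g A (adjoint_operator g Z v)"
  have h: "square_summable ?h" "l2norm ?h \<le> (\<kappa>\<^sup>2 * norm A) * l2norm (adjoint_operator g Z)"
    using square_summable_dominated[OF square_summable_adjoint[OF Z], of "\<kappa>\<^sup>2 * norm A" ?h]
      l2norm_dominated[OF square_summable_adjoint[OF Z], of "\<kappa>\<^sup>2 * norm A" ?h] N_adjoint[OF A]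
    by auto
  have ZA: "clinear (blinfun_apply (Z o\<^sub>L A))"
    using Z(1) A by (rule clinear_blinfun_compose)
  have "adjoint_operator g (Z o\<^sub>L A) = ?h"
    by (intro ext ip_right_unique)
       (metis adjoint_operator A Z(1) ZA blinfun_apply_blinfun_compose)
  hence "((\<lambda>v. (N ((Z o\<^sub>L A) v))\<^sup>2) has_sum (l2norm ?h)\<^sup>2) E"
    using square_summable_if_adjoint[OF ZA] has_sum_l2norm[OF h(1)] by simp
  from l2normI[OF this] h(2) show "square_summable (blinfun_apply (Z o\<^sub>L A))"
    "l2norm (blinfun_apply (Z o\<^sub>L A)) \<le> (\<kappa>\<^sup>2 * norm A) * l2norm (blinfun_apply Z)"
    by (simp_all add: l2norm_adjoint[OF Z] blinfun_compose.rep_eq o_def)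
qed

text \<open>An operator that vanishes on the complement of \<open>coord B\<^sub>0\<close> has its adjoint mapping into
  \<open>coord B\<^sub>0\<close>.  Passing to the adjoint and back therefore exchanges an arbitrary orthonormal basis of
  \<open>coord B\<^sub>0\<close> for \<open>E\<close>.\<close>

lemma has_sum_basis_independent:
  assumes B0: "B0 \<subseteq> E" and T: "T \<in> operators g (coord B0) V"
    and B: "orthonormal_basis g (coord B0) B"
  shows "((\<lambda>v. (N (T v))\<^sup>2) has_sum s) B \<longleftrightarrow> ((\<lambda>v. (N (T v))\<^sup>2) has_sum s) E"
proof -
  let ?T' = "adjoint_operator g T"
  have lin: "clinear (blinfun_apply T)" and zero: "\<And>v. v \<in> coord (E - B0) \<Longrightarrow> T v = 0"
    using T perp_coord[OF B0] by (auto simp: operators_def)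
  have adj: "ip (T b) c = ip b (?T' c)" and adj': "ip (?T' c) b = ip c (T b)" for b c
    by (metis adjoint_operator[OF lin] ip_sym)+
  have range: "?T' c \<in> coord B0" for c
  proof -
    have "?T' c \<in> perp g (coord (E - B0))"
      using zero by (simp add: perp_def adj' ip.zero_right)
    moreover have "E - (E - B0) = B0" using B0 by blast
    ultimately show ?thesis using perp_coord[of "E - B0"] by simp
  qed
  show ?thesis
  proof
    assume "((\<lambda>v. (N (T v))\<^sup>2) has_sum s) B"
    with has_sum_adjoint[OF B frame, of "blinfun_apply T" ?T'] range adj
    have "((\<lambda>v. (N (?T' v))\<^sup>2) has_sum s) E" by simp
    with has_sum_adjoint[OF frame frame, of ?T' "blinfun_apply T"] adj'
    show "((\<lambda>v. (N (T v))\<^sup>2) has_sum s) E" by simp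
  next
    assume "((\<lambda>v. (N (T v))\<^sup>2) has_sum s) E"
    with has_sum_adjoint[OF frame frame, of "blinfun_apply T" ?T'] adj
    have "((\<lambda>v. (N (?T' v))\<^sup>2) has_sum s) E" by simp
    with has_sum_adjoint[OF frame B, of ?T' "blinfun_apply T"] range adj'
    show "((\<lambda>v. (N (T v))\<^sup>2) has_sum s) B" by simp
  qed
qed

lemma
  assumes B0: "B0 \<subseteq> E" and T: "T \<in> operators g (coord B0) V"
  shows hilbert_schmidt_iff: "hilbert_schmidt g (coord B0) T \<longleftrightarrow> square_summable (blinfun_apply T)"
    and hs_norm_eq:
      "square_summable (blinfun_apply T) \<Longrightarrow> hs_norm g (coord B0) T = l2norm (blinfun_apply T)"
proof -
  note indep = has_sum_basis_independent[OF B0 T]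
  show "hilbert_schmidt g (coord B0) T \<longleftrightarrow> square_summable (blinfun_apply T)"
    using indep orthonormal_basis_coord[OF B0]
    unfolding hilbert_schmidt_def square_summable_def summable_on_def by blast
  assume "square_summable (blinfun_apply T)"
  moreover have "orthonormal_basis g (coord B0) (SOME B. orthonormal_basis g (coord B0) B)"
    using orthonormal_basis_coord[OF B0] by (rule someI)
  ultimately have "((\<lambda>v. (N (T v))\<^sup>2) has_sum (l2norm (blinfun_apply T))\<^sup>2)
      (SOME B. orthonormal_basis g (coord B0) B)"
    using indep has_sum_l2norm by blast
  thus "hs_norm g (coord B0) T = l2norm (blinfun_apply T)"
    unfolding hs_norm_def by (simp add: infsumI)
qed

end

section \<open>Small perturbations of the identity\<close>

text \<open>The equation \<open>x + Kx = y\<close> is solved by Banach's fixed point theorem for \<open>x \<mapsto> y - Kx\<close>.\<close>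

lemma inverse_of_perturbed_identity:
  fixes K :: "'a::{real_normed_vector, complete_space} cplxn \<Rightarrow>\<^sub>L 'a cplxn"
  assumes K: "clinear (blinfun_apply K)" "norm K < 1"
  obtains R where "clinear (blinfun_apply R)" "\<And>x. blinfun_apply R (x + blinfun_apply K x) = x"
    "\<And>y. blinfun_apply R y + blinfun_apply K (blinfun_apply R y) = y"
proof -
  have ex1: "\<exists>!x. x + K x = y" for y
  proof -
    have "\<exists>!x. y - K x = x"
    proof (rule banach_fix_type)
      show "\<forall>x x'. dist (y - K x) (y - K x') \<le> norm K * dist x x'"
        using norm_blinfun[of K]
        by (simp add: dist_norm blinfun.diff_right[symmetric]) (metis norm_minus_commute)
    qed (use K in auto)
    moreover have "y - K x = x \<longleftrightarrow> x + K x = y" for x by (auto simp: algebra_simps)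
    ultimately show ?thesis by simp
  qed
  define r where "r y = (THE x. x + K x = y)" for y
  have r: "r y + K (r y) = y" for y
    unfolding r_def by (rule theI'[OF ex1])
  have r_unique: "r y = x" if "x + K x = y" for x y
    using ex1[of y] r[of y] that by blast
  have r_add: "r (y + y') = r y + r y'" for y y'
    using r[of y] r[of y'] by (intro r_unique) (simp add: blinfun.add_right algebra_simps)
  have r_cscale: "r (cscale k y) = cscale k (r y)" for k y
    using r[of y] by (intro r_unique) (metis clinear_cscale[OF K(1)] cvs.scale_right_distrib)
  have r_scaleR: "r (t *\<^sub>R y) = t *\<^sub>R r y" for t y
    using r[of y] by (intro r_unique) (metis blinfun.scaleR_right scaleR_right_distrib)
  have bound: "norm (r y) \<le> norm y * (1 / (1 - norm K))" for y
  proof -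
    have "norm (r y) \<le> norm (r y + K (r y)) + norm (K (r y))"
      using norm_triangle_ineq4[of "r y + K (r y)" "K (r y)"] by simp
    also have "\<dots> \<le> norm y + norm K * norm (r y)"
      unfolding r using norm_blinfun[of K "r y"] by simp
    finally show ?thesis using K(2) by (simp add: field_simps)
  qed
  have "bounded_linear r"
    using r_add r_scaleR bound by (rule bounded_linear_intro)
  hence R: "blinfun_apply (Blinfun r) = r" by (rule bounded_linear_Blinfun_apply)
  show ?thesis
  proof (rule that[of "Blinfun r"])
    show "clinear (blinfun_apply (Blinfun r))" by (simp add: R clinear_iff r_add r_cscale)
    show "Blinfun r (x + K x) = x" for x unfolding R by (rule r_unique) simp
    show "Blinfun r y + K (Blinfun r y) = y" for y unfolding R by (rule r)
  qed
qed

section \<open>Operators between coordinate subspaces\<close>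

lemma blinfun_apply_op_cscale:
  "blinfun_apply (op_cscale k X) v = cscale k (blinfun_apply X v)"
  unfolding op_cscale_def
  by (simp add: bounded_linear_Blinfun_apply bounded_linear_compose[OF bounded_linear_cscale]
      blinfun.bounded_linear_right)

lemma operatorsD:
  assumes "T \<in> operators g W V"
  shows "clinear (blinfun_apply T)" "blinfun_apply T v \<in> V" "v \<in> perp g W \<Longrightarrow> blinfun_apply T v = 0"
  using assms by (auto simp: operators_def)

lemma operators_compose:
  assumes "S \<in> operators g V U" "T \<in> operators g W V'"
  shows "S o\<^sub>L T \<in> operators g W U"
  using assms by (auto simp: operators_def blinfun.zero_right intro: clinear_blinfun_compose)

lemma operators_plus_minus:
  assumes V: "cvs.subspace V" and ST: "S \<in> operators g W V" "T \<in> operators g W V"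
  shows "S + T \<in> operators g W V" "S - T \<in> operators g W V"
proof -
  note lin = ST[THEN operatorsD(1)]
  have "clinear (blinfun_apply (S + T))" "clinear (blinfun_apply (S - T))"
    unfolding clinear_iff blinfun.add_left blinfun.diff_left
    by (simp_all
        add: clinear_add[OF lin(1)] clinear_add[OF lin(2)] clinear_cscale[OF lin(1)]
          clinear_cscale[OF lin(2)] cvs.scale_right_distrib cvs.scale_right_diff_distrib)
  thus "S + T \<in> operators g W V" "S - T \<in> operators g W V"
    using ST V unfolding operators_def
    by (auto simp: blinfun.add_left blinfun.diff_left cvs.subspace_add cvs.subspace_diff)
qed

context orthonormal_frame
begin

lemma blinfun_eq_on_coord:
  assumes "B \<subseteq> E" "\<And>v. v \<in> coord B \<Longrightarrow> blinfun_apply S v = blinfun_apply T v"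
    "\<And>v. v \<in> coord (E - B) \<Longrightarrow> blinfun_apply S v = blinfun_apply T v"
  shows "S = T"
proof (rule blinfun_eqI)
  fix v
  obtain p q where "p \<in> coord B" "q \<in> coord (E - B)" "v = p + q"
    using coord_decomposition[OF assms(1)] by blast
  thus "S v = T v" using assms by (simp add: blinfun.add_right)
qed

lemma is_bounded_inverse_inverse_operator:
  assumes B: "B \<subseteq> E" and inv: "has_bounded_inverse g W (coord B) A"
  shows "is_bounded_inverse g W (coord B) A (inverse_operator g W (coord B) A)"
proof -
  have "T = T'" if T: "is_bounded_inverse g W (coord B) A T"
    and T': "is_bounded_inverse g W (coord B) A T'" for T T'
  proof (rule blinfun_eq_on_coord[OF B])
    fix v assume v: "v \<in> coord B"
    have "T v = T (A (T' v))" using T' v by (simp add: is_bounded_inverse_def)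
    also have "\<dots> = T' v" using T T' by (simp add: is_bounded_inverse_def operators_def)
    finally show "T v = T' v" .
  next
    fix v assume "v \<in> coord (E - B)"
    thus "T v = T' v"
      using T T' by (simp add: is_bounded_inverse_def operators_def perp_coord[OF B])
  qed
  with inv show ?thesis
    unfolding has_bounded_inverse_def inverse_operator_def by (metis (mono_tags, lifting) theI)
qed

section \<open>The complex bilinear form and Lagrangian subspaces\<close>

text \<open>The condition \<open>\<alpha>Z\<alpha> = -Z\<^sup>*\<close> is skewness of \<open>Z\<close> for the complex bilinear extension of \<open>g\<close>,
  which is symmetric.\<close>

definition bf :: "'a cplxn \<Rightarrow> 'a cplxn \<Rightarrow> complex" where
  "bf v w = ip v (cconj w)"

lemma bf_sym: "bf v w = bf w v"
  unfolding bf_def by (metis cconj_cconj ip_cconj ip_sym)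

lemma bf_add: "bf (u + v) w = bf u w + bf v w" "bf w (u + v) = bf w u + bf w v"
  by (simp_all add: bf_def ip.add_left ip.add_right cconj_add)

lemma bf_diff: "bf (u - v) w = bf u w - bf v w" "bf w (u - v) = bf w u - bf w v"
  by (simp_all add: bf_def ip.diff_left ip.diff_right cconj_diff)

definition skew :: "('a cplxn \<Rightarrow>\<^sub>L 'a cplxn) \<Rightarrow> bool" where
  "skew Z \<longleftrightarrow> (\<forall>v w. bf (Z v) w = - bf v (Z w))"

lemma skew_iff:
  assumes Z: "clinear (blinfun_apply Z)"
  shows "(\<forall>v. cconj (Z (cconj v)) = - adjoint_operator g Z v) \<longleftrightarrow> skew Z"
proof
  assume *: "\<forall>v. cconj (Z (cconj v)) = - adjoint_operator g Z v"
  show "skew Z"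
    unfolding skew_def
  proof (intro allI)
    fix v w
    have "adjoint_operator g Z (cconj w) = - cconj (Z w)"
      using *[rule_format, of "cconj w"] by simp
    thus "bf (Z v) w = - bf v (Z w)"
      by (simp add: bf_def adjoint_operator[OF Z] ip.minus_right)
  qed
next
  assume *: "skew Z"
  show "\<forall>v. cconj (Z (cconj v)) = - adjoint_operator g Z v"
  proof (intro allI ip_right_unique)
    fix v u
    have "ip u (adjoint_operator g Z v) = bf (Z u) (cconj v)"
      by (simp add: bf_def adjoint_operator[OF Z])
    also have "\<dots> = - bf u (Z (cconj v))" using * unfolding skew_def by blast
    finally show "ip u (cconj (Z (cconj v))) = ip u (- adjoint_operator g Z v)"
      by (simp add: bf_def ip.minus_right)
  qed
qed

text \<open>The base points \<open>W\<^sub>S\<close> of the charts are \<open>coord B\<close> for such \<open>B\<close>: conjugation exchanges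
  \<open>coord B\<close> with its orthogonal complement, so both are Lagrangian for the bilinear form.\<close>

definition polarizing :: "'a cplxn set \<Rightarrow> bool" where
  "polarizing B \<longleftrightarrow> B \<subseteq> E \<and> cconj ` B = E - B"

lemma polarizing_subset: "polarizing B \<Longrightarrow> B \<subseteq> E"
  by (simp add: polarizing_def)

lemma cconj_coord:
  assumes B: "polarizing B"
  shows "z \<in> coord B \<Longrightarrow> cconj z \<in> coord (E - B)" "z \<in> coord (E - B) \<Longrightarrow> cconj z \<in> coord B"
proof -
  have eq: "coord B = perp g (cconj ` B)" "coord (E - B) = perp g B"
  proof -
    have "E - (E - B) = B" using B by (auto simp: polarizing_def)
    thus "coord B = perp g (cconj ` B)" "coord (E - B) = perp g B"
      using coord_eq_perp[of B] coord_eq_perp[of "E - B"] B by (auto simp: polarizing_def)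
  qed
  have conj: "ip (cconj z) w = cnj (ip z (cconj w))" for w by (metis cconj_cconj ip_cconj)
  show "z \<in> coord B \<Longrightarrow> cconj z \<in> coord (E - B)"
    unfolding eq by (auto simp: perp_def conj)
  show "z \<in> coord (E - B) \<Longrightarrow> cconj z \<in> coord B"
    unfolding eq by (auto simp: perp_def conj)
qed

lemma isotropic:
  assumes B: "polarizing B"
  shows "v \<in> coord B \<Longrightarrow> w \<in> coord B \<Longrightarrow> bf v w = 0"
    "v \<in> coord (E - B) \<Longrightarrow> w \<in> coord (E - B) \<Longrightarrow> bf v w = 0"
  using ip_coord[OF polarizing_subset[OF B]] cconj_coord[OF B] by (auto simp: bf_def)

lemma skewI:
  assumes B: "polarizing B" and Z: "Z \<in> operators g (coord B) (coord (E - B))"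
    and skew: "\<And>v w. v \<in> coord B \<Longrightarrow> w \<in> coord B \<Longrightarrow> bf (Z v) w + bf v (Z w) = 0"
  shows "skew Z"
  unfolding skew_def
proof (intro allI)
  fix v w
  note sub = polarizing_subset[OF B]
  obtain v1 v2 where v: "v1 \<in> coord B" "v2 \<in> coord (E - B)" "v = v1 + v2"
    using coord_decomposition[OF sub] by blast
  obtain w1 w2 where w: "w1 \<in> coord B" "w2 \<in> coord (E - B)" "w = w1 + w2"
    using coord_decomposition[OF sub] by blast
  have "Z v2 = 0" "Z w2 = 0" using operatorsD(3)[OF Z] v w perp_coord[OF sub] by auto
  hence "Z v = Z v1" "Z w = Z w1" by (simp_all add: v w blinfun.add_right)
  moreover have "bf (Z v1) w2 = 0" "bf v2 (Z w1) = 0"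
    using isotropic(2)[OF B] operatorsD(2)[OF Z] v w by blast+
  ultimately show "bf (Z v) w = - bf v (Z w)"
    using skew[OF v(1) w(1)] by (simp add: v w bf_add add_eq_0_iff)
qed

text \<open>Only the mixed terms survive, as both subspaces are isotropic; they cancel if \<open>Z\<close> is skew, so the
  graph of a skew operator is isotropic.\<close>

lemma bf_graph:
  assumes "polarizing B" "Z \<in> operators g (coord B) (coord (E - B))" "v \<in> coord B" "w \<in> coord B"
  shows "bf (v + Z v) (w + Z w) = bf (Z v) w + bf v (Z w)"
  using isotropic[OF assms(1)] assms(3,4) operatorsD(2)[OF assms(2)] by (simp add: bf_add)

lemma B2_alpha_iff:
  assumes B: "polarizing B"
  shows "Z \<in> B2_alpha g (coord B) \<longleftrightarrow>
    Z \<in> operators g (coord B) (coord (E - B)) \<and> square_summable (blinfun_apply Z) \<and> skew Z"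
proof -
  note sub = polarizing_subset[OF B]
  show ?thesis
    unfolding B2_alpha_def perp_coord[OF sub] mem_Collect_eq
    by (metis hilbert_schmidt_iff[OF sub] skew_iff operatorsD(1))
qed

lemma hs_norm_B2_alpha:
  assumes B: "polarizing B" and Z: "Z \<in> B2_alpha g (coord B)"
  shows "hs_norm g (coord B) Z = l2norm (blinfun_apply Z)"
  using Z hs_norm_eq[OF polarizing_subset[OF B]] unfolding B2_alpha_iff[OF B] by blast

lemma N_minus: "N (- z) = N z"
  by (simp add: g_norm_def ip.minus_left ip.minus_right)

lemma B2_alpha_diff:
  assumes B: "polarizing B" and XY: "X \<in> B2_alpha g (coord B)" "Y \<in> B2_alpha g (coord B)"
  shows "X - Y \<in> B2_alpha g (coord B)"
proof -
  have "E - B \<subseteq> E" by blast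
  hence "X - Y \<in> operators g (coord B) (coord (E - B))"
    using XY unfolding B2_alpha_iff[OF B] by (intro operators_plus_minus(2) subspace_coord) auto
  moreover have "square_summable (\<lambda>v. X v + - Y v)"
  proof (rule square_summable_add)
    show "square_summable (\<lambda>v. - Y v)"
      using XY unfolding B2_alpha_iff[OF B] by (simp add: square_summable_def N_minus)
  qed (use XY in \<open>simp add: B2_alpha_iff[OF B]\<close>)
  moreover have "blinfun_apply (X - Y) = (\<lambda>v. X v + - Y v)"
    by (auto simp: blinfun.diff_left)
  moreover have "skew (X - Y)"
    using XY unfolding B2_alpha_iff[OF B] skew_def by (simp add: blinfun.diff_left bf_diff)
  ultimately show ?thesis unfolding B2_alpha_iff[OF B] by simp
qed

lemma Metric_space_B2_alpha:
  assumes B: "polarizing B"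
  shows "Metric_space (B2_alpha g (coord B)) (\<lambda>X Y. hs_norm g (coord B) (X - Y))"
proof
  fix X Y :: "'a cplxn \<Rightarrow>\<^sub>L 'a cplxn"
  show "0 \<le> hs_norm g (coord B) (X - Y)"
    unfolding hs_norm_def by (intro real_sqrt_ge_zero infsum_nonneg) simp
  show "hs_norm g (coord B) (X - Y) = hs_norm g (coord B) (Y - X)"
    unfolding hs_norm_def blinfun.diff_left by (metis N_minus minus_diff_eq)
next
  fix X Y assume XY: "X \<in> B2_alpha g (coord B)" "Y \<in> B2_alpha g (coord B)"
  note diff = B2_alpha_diff[OF B XY]
  have "norm (X - Y) \<le> \<kappa>\<^sup>2 * l2norm (blinfun_apply (X - Y))"
    using diff unfolding B2_alpha_iff[OF B] by (blast intro: norm_le_l2norm operatorsD(1))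
  thus "hs_norm g (coord B) (X - Y) = 0 \<longleftrightarrow> X = Y"
    unfolding hs_norm_B2_alpha[OF B diff] by (auto simp: l2norm_def)
next
  fix X Y Z
  assume XYZ: "X \<in> B2_alpha g (coord B)" "Y \<in> B2_alpha g (coord B)" "Z \<in> B2_alpha g (coord B)"
  note diff = B2_alpha_diff[OF B]
  have "blinfun_apply (X - Z) = (\<lambda>v. (X - Y) v + (Y - Z) v)"
    by (auto simp: blinfun.diff_left)
  thus "hs_norm g (coord B) (X - Z) \<le> hs_norm g (coord B) (X - Y) + hs_norm g (coord B) (Y - Z)"
    using l2norm_triangle[of "blinfun_apply (X - Y)" "blinfun_apply (Y - Z)"]
      diff[OF XYZ(1,2)] diff[OF XYZ(2,3)] diff[OF XYZ(1,3)] B2_alpha_iff[OF B]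
    by (simp add: hs_norm_B2_alpha[OF B])
qed

end

section \<open>The transition function\<close>

text \<open>Finiteness of \<open>B1 - B2\<close> is what remains of the finiteness of \<open>S\<^sub>1\<close> and \<open>S\<^sub>2\<close>; it makes \<open>c\<close> an operator of
  finite rank.\<close>

locale transition = orthonormal_frame g E
  for g :: "'a::{real_normed_vector, complete_space} \<Rightarrow> 'a \<Rightarrow> real" and E :: "'a cplxn set" +
  fixes B1 B2 :: "'a cplxn set" and a b c d :: "'a cplxn \<Rightarrow>\<^sub>L 'a cplxn"
  assumes B1: "polarizing B1" and B2: "polarizing B2" and finite_diff: "finite (B1 - B2)"
    and a: "a \<in> operators g (coord B1) (coord B2)"
    and b: "b \<in> operators g (coord (E - B1)) (coord B2)"
    and c: "c \<in> operators g (coord B1) (coord (E - B2))"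
    and d: "d \<in> operators g (coord (E - B1)) (coord (E - B2))"
    and identity: "\<And>v w. v \<in> coord B1 \<Longrightarrow> w \<in> coord (E - B1) \<Longrightarrow> (a v + b w) + (c v + d w) = v + w"
begin

abbreviation "W1 \<equiv> coord B1"
abbreviation "W1' \<equiv> coord (E - B1)"
abbreviation "W2 \<equiv> coord B2"
abbreviation "W2' \<equiv> coord (E - B2)"

definition "denom Z = a + (b o\<^sub>L Z)"
definition "numer Z = c + (d o\<^sub>L Z)"
definition "inv_denom Z = inverse_operator g W1 W2 (denom Z)"
definition "chart_change Z = numer Z o\<^sub>L inv_denom Z"
definition "U = {Z \<in> B2_alpha g W1. has_bounded_inverse g W1 W2 (denom Z)}"

lemmas sub1 = polarizing_subset[OF B1]
lemmas sub2 = polarizing_subset[OF B2]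

lemma subspaces: "cvs.subspace W1" "cvs.subspace W1'" "cvs.subspace W2" "cvs.subspace W2'"
  using sub1 sub2 by (auto intro: subspace_coord)

lemma identity1: "v \<in> W1 \<Longrightarrow> a v + c v = v"
  using identity[of v 0] cvs.subspace_0[OF subspaces(2)] by (simp add: blinfun.zero_right)

lemma identity2: "w \<in> W1' \<Longrightarrow> b w + d w = w"
  using identity[of 0 w] cvs.subspace_0[OF subspaces(1)] by (simp add: blinfun.zero_right)

lemma U_D:
  assumes "Z \<in> U"
  shows "Z \<in> B2_alpha g W1" "Z \<in> operators g W1 W1'" "square_summable (blinfun_apply Z)"
    "skew Z" "clinear (blinfun_apply Z)" "Z v \<in> W1'"
  using assms operatorsD[of Z g W1 W1'] by (auto simp: U_def B2_alpha_iff[OF B1])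

lemma numer_operators: "Z \<in> operators g W1 W1' \<Longrightarrow> numer Z \<in> operators g W1 W2'"
  unfolding numer_def by (intro operators_plus_minus(1) subspaces c operators_compose[OF d])

lemma denom_plus_numer:
  assumes "Z \<in> operators g W1 W1'" "v \<in> W1"
  shows "denom Z v + numer Z v = v + Z v"
  using identity[OF assms(2) operatorsD(2)[OF assms(1)]]
  by (simp add: denom_def numer_def blinfun.add_left)

lemma inv_denom:
  assumes "Z \<in> U"
  shows "inv_denom Z \<in> operators g W2 W1"
    and "v \<in> W1 \<Longrightarrow> inv_denom Z (denom Z v) = v"
    and "u \<in> W2 \<Longrightarrow> denom Z (inv_denom Z u) = u"
  using is_bounded_inverse_inverse_operator[OF sub2, of W1 "denom Z"] assms
  by (auto simp: inv_denom_def U_def is_bounded_inverse_def)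

lemma chart_change_operators: "Z \<in> U \<Longrightarrow> chart_change Z \<in> operators g W2 W2'"
  unfolding chart_change_def by (rule operators_compose[OF numer_operators inv_denom(1)]) (auto dest: U_D)

text \<open>Numerator and denominator add up to the identity on the graph of \<open>Z\<close>, so this graph is also
  that of \<open>chart_change Z\<close>.\<close>

lemma chart_change_graph:
  assumes Z: "Z \<in> U" and u: "u \<in> W2"
  shows "u + chart_change Z u = inv_denom Z u + Z (inv_denom Z u)"
  using denom_plus_numer[OF U_D(2)[OF Z] operatorsD(2)[OF inv_denom(1)[OF Z]], of u]
    inv_denom(3)[OF Z u] by (simp add: chart_change_def)

text \<open>On a basis vector that \<open>B1\<close> and \<open>B2\<close> share, \<open>c\<close> vanishes: \<open>a\<close> already produces
  the vector itself.\<close>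

lemma square_summable_c: "square_summable (blinfun_apply c)"
proof -
  have zero: "c v = 0" if v: "v \<in> E - (B1 - B2)" for v
  proof (cases "v \<in> B1")
    case True
    hence "v \<in> W1" "v \<in> W2"
      using v unfolding coord_def by (auto intro!: closure_subset[THEN subsetD] cvs.span_base)
    have "c v = v - a v" using identity1[OF \<open>v \<in> W1\<close>] by (simp add: algebra_simps)
    hence "c v \<in> W2"
      using \<open>v \<in> W2\<close> operatorsD(2)[OF a] by (simp add: cvs.subspace_diff[OF subspaces(3)])
    hence "ip (c v) (c v) = 0" using ip_coord(1)[OF sub2] operatorsD(2)[OF c] by blast
    thus ?thesis by (simp add: ip_self_eq_0_iff)
  next
    case False
    hence "v \<in> W1'"
      using v unfolding coord_def by (auto intro!: closure_subset[THEN subsetD] cvs.span_base)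
    thus ?thesis using operatorsD(3)[OF c] perp_coord[OF sub1] by simp
  qed
  have "(\<lambda>v. (N (c v))\<^sup>2) summable_on (B1 - B2)" using finite_diff by (rule summable_on_finite)
  also have "(\<lambda>v. (N (c v))\<^sup>2) summable_on (B1 - B2) \<longleftrightarrow> (\<lambda>v. (N (c v))\<^sup>2) summable_on E"
    by (rule summable_on_cong_neutral) (use zero sub1 in auto)
  finally show ?thesis unfolding square_summable_def .
qed

text \<open>\<open>Z\<close> is skew exactly if its graph is isotropic, so skewness passes from \<open>Z\<close> to
  \<open>chart_change Z\<close> through the common graph.\<close>

lemma chart_change_in_B2_alpha:
  assumes Z: "Z \<in> U"
  shows "chart_change Z \<in> B2_alpha g W2"
  unfolding B2_alpha_iff[OF B2]
proof (intro conjI)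
  show T: "chart_change Z \<in> operators g W2 W2'" using Z by (rule chart_change_operators)
  have "blinfun_apply (numer Z) = (\<lambda>v. c v + (d o\<^sub>L Z) v)"
    by (auto simp: numer_def blinfun.add_left)
  hence "square_summable (blinfun_apply (numer Z))"
    using square_summable_add[OF square_summable_c square_summable_compose_left[OF U_D(3)[OF Z]]]
    by simp
  thus "square_summable (blinfun_apply (chart_change Z))"
    unfolding chart_change_def using numer_operators[OF U_D(2)[OF Z]] inv_denom(1)[OF Z]
    by (intro square_summable_compose_right) (auto dest: operatorsD(1))
  show "skew (chart_change Z)"
  proof (rule skewI[OF B2 T])
    fix u w assume uw: "u \<in> W2" "w \<in> W2"
    let ?y = "inv_denom Z u" and ?x = "inv_denom Z w"
    have in_W1: "?y \<in> W1" "?x \<in> W1" using operatorsD(2)[OF inv_denom(1)[OF Z]] by auto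
    have "bf (chart_change Z u) w + bf u (chart_change Z w) = bf (u + chart_change Z u) (w + chart_change Z w)"
      using bf_graph[OF B2 T uw] by simp
    also have "\<dots> = bf (?y + Z ?y) (?x + Z ?x)"
      using chart_change_graph[OF Z] uw by simp
    also have "\<dots> = bf (Z ?y) ?x + bf ?y (Z ?x)"
      by (rule bf_graph[OF B1 U_D(2)[OF Z] in_W1])
    also have "\<dots> = 0" using U_D(4)[OF Z] by (simp add: skew_def)
    finally show "bf (chart_change Z u) w + bf u (chart_change Z w) = 0" .
  qed
qed

text \<open>A change \<open>X\<close> of \<open>Z\<close> changes the numerator by \<open>d X\<close> and the denominator by \<open>b X\<close>; the latter
  enters the quotient through \<open>- chart_change Z \<circ> b \<circ> X\<close>, as for fractions of numbers.\<close>

definition "slope Z = d - (chart_change Z o\<^sub>L b)"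
definition "derivative Z X = slope Z o\<^sub>L X o\<^sub>L inv_denom Z"

lemma slope_operators: "Z \<in> U \<Longrightarrow> slope Z \<in> operators g W1' W2'"
  unfolding slope_def
  by (intro operators_plus_minus(2) subspaces d operators_compose[OF chart_change_operators b])

lemma derivative_in_B2_alpha:
  assumes Z: "Z \<in> U" and X: "X \<in> B2_alpha g W1"
  shows "derivative Z X \<in> B2_alpha g W2"
  unfolding B2_alpha_iff[OF B2]
proof (intro conjI)
  have X': "X \<in> operators g W1 W1'" "square_summable (blinfun_apply X)" "skew X"
    using X unfolding B2_alpha_iff[OF B1] by auto
  have MX: "slope Z o\<^sub>L X \<in> operators g W1 W2'"
    by (rule operators_compose[OF slope_operators[OF Z] X'(1)])
  show D: "derivative Z X \<in> operators g W2 W2'"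
    unfolding derivative_def by (rule operators_compose[OF MX inv_denom(1)[OF Z]])
  show "square_summable (blinfun_apply (derivative Z X))"
    unfolding derivative_def
    using operatorsD(1)[OF MX] operatorsD(1)[OF inv_denom(1)[OF Z]]
    by (intro square_summable_compose_right square_summable_compose_left X')
  \<comment> \<open>Isotropy of \<open>W2\<close> and \<open>W2'\<close> allows both \<open>d X\<close> and \<open>b X\<close> to be replaced by \<open>X\<close>; then the common
    graph of \<open>Z\<close> and \<open>chart_change Z\<close> leads back to \<open>W1\<close>.\<close>
  have pullback: "bf (derivative Z X u) w = bf (X (inv_denom Z u)) (inv_denom Z w)"
    if u: "u \<in> W2" and w: "w \<in> W2" for u w
  proof -
    let ?y = "inv_denom Z u" and ?x = "inv_denom Z w"
    have Xy: "X ?y \<in> W1'" by (rule operatorsD(2)[OF X'(1)])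
    have id: "d (X ?y) = X ?y - b (X ?y)" "b (X ?y) = X ?y - d (X ?y)"
      using identity2[OF Xy] by (simp_all add: algebra_simps)
    have "bf (d (X ?y)) w = bf (X ?y) w"
      unfolding id(1) bf_diff using isotropic(1)[OF B2 operatorsD(2)[OF b] w] by simp
    moreover have "bf (chart_change Z (b (X ?y))) w = - bf (X ?y) (chart_change Z w)"
    proof -
      have "skew (chart_change Z)" using chart_change_in_B2_alpha[OF Z] unfolding B2_alpha_iff[OF B2] by blast
      hence "bf (chart_change Z (b (X ?y))) w = - bf (b (X ?y)) (chart_change Z w)" by (simp add: skew_def)
      also have "\<dots> = - bf (X ?y) (chart_change Z w)"
        unfolding id(2) bf_diff
        using isotropic(2)[OF B2 operatorsD(2)[OF d] operatorsD(2)[OF chart_change_operators[OF Z]]] by simp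
      finally show ?thesis .
    qed
    ultimately have "bf (derivative Z X u) w = bf (X ?y) (w + chart_change Z w)"
      by (simp add: derivative_def slope_def blinfun.diff_left bf_diff bf_add)
    also have "\<dots> = bf (X ?y) (?x + Z ?x)" by (simp add: chart_change_graph[OF Z w])
    also have "\<dots> = bf (X ?y) ?x"
      using isotropic(2)[OF B1 Xy U_D(6)[OF Z]] by (simp add: bf_add)
    finally show ?thesis .
  qed
  show "skew (derivative Z X)"
  proof (rule skewI[OF B2 D])
    fix u w assume uw: "u \<in> W2" "w \<in> W2"
    have "bf u (derivative Z X w) = bf (X (inv_denom Z w)) (inv_denom Z u)"
      using pullback[OF uw(2,1)] bf_sym by metis
    also have "\<dots> = - bf (X (inv_denom Z u)) (inv_denom Z w)"
      using X'(3) bf_sym unfolding skew_def by metis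
    finally show "bf (derivative Z X u) w + bf u (derivative Z X w) = 0"
      using pullback[OF uw] by simp
  qed
qed

lemma resolvent_identity:
  assumes Y: "Y \<in> U" and Z: "Z \<in> U"
  shows "inv_denom Y = inv_denom Z - (inv_denom Z o\<^sub>L b o\<^sub>L (Y - Z) o\<^sub>L inv_denom Y)"
proof (rule blinfun_eq_on_coord[OF sub2])
  fix u assume u: "u \<in> W2"
  let ?x = "inv_denom Y u"
  have x: "?x \<in> W1" by (rule operatorsD(2)[OF inv_denom(1)[OF Y]])
  have "b ((Y - Z) ?x) = denom Y ?x - denom Z ?x"
    by (simp add: denom_def blinfun.add_left blinfun.diff_left blinfun.diff_right)
  also have "\<dots> = u - denom Z ?x" by (simp add: inv_denom(3)[OF Y u])
  finally have "inv_denom Z (b ((Y - Z) ?x)) = inv_denom Z u - ?x"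
    by (simp add: blinfun.diff_right inv_denom(2)[OF Z x])
  thus "inv_denom Y u = (inv_denom Z - (inv_denom Z o\<^sub>L b o\<^sub>L (Y - Z) o\<^sub>L inv_denom Y)) u"
    by (simp add: blinfun.diff_left)
next
  fix u assume "u \<in> W2'"
  hence "inv_denom Y u = 0" "inv_denom Z u = 0"
    using operatorsD(3)[OF inv_denom(1)] Y Z perp_coord[OF sub2] by auto
  thus "inv_denom Y u = (inv_denom Z - (inv_denom Z o\<^sub>L b o\<^sub>L (Y - Z) o\<^sub>L inv_denom Y)) u"
    by (simp add: blinfun.diff_left blinfun.zero_right)
qed

text \<open>This is an exact formula; only the last factor distinguishes it from the derivative.\<close>

lemma chart_change_difference:
  assumes Y: "Y \<in> U" and Z: "Z \<in> U"
  shows "chart_change Y - chart_change Z = slope Z o\<^sub>L (Y - Z) o\<^sub>L inv_denom Y"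
proof (rule blinfun_eq_on_coord[OF sub2])
  fix u assume u: "u \<in> W2"
  let ?x = "inv_denom Y u"
  have x: "?x \<in> W1" by (rule operatorsD(2)[OF inv_denom(1)[OF Y]])
  have "u = denom Y ?x" by (simp add: inv_denom(3)[OF Y u])
  also have "\<dots> = denom Z ?x + b ((Y - Z) ?x)"
    by (simp add: denom_def blinfun.add_left blinfun.diff_left blinfun.diff_right)
  finally have "chart_change Z u = chart_change Z (denom Z ?x) + chart_change Z (b ((Y - Z) ?x))"
    by (metis blinfun.add_right)
  also have "chart_change Z (denom Z ?x) = numer Z ?x"
    by (simp add: chart_change_def inv_denom(2)[OF Z x])
  finally have "chart_change Z u = numer Z ?x + chart_change Z (b ((Y - Z) ?x))" .
  moreover have "chart_change Y u = numer Z ?x + d ((Y - Z) ?x)"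
    by (simp add: chart_change_def numer_def blinfun.add_left blinfun.diff_left blinfun.diff_right)
  ultimately show "(chart_change Y - chart_change Z) u = (slope Z o\<^sub>L (Y - Z) o\<^sub>L inv_denom Y) u"
    by (simp add: slope_def blinfun.diff_left)
next
  fix u assume "u \<in> W2'"
  hence "inv_denom Y u = 0" "inv_denom Z u = 0"
    using operatorsD(3)[OF inv_denom(1)] Y Z perp_coord[OF sub2] by auto
  thus "(chart_change Y - chart_change Z) u = (slope Z o\<^sub>L (Y - Z) o\<^sub>L inv_denom Y) u"
    by (simp add: chart_change_def blinfun.diff_left blinfun.zero_right)
qed

text \<open>The constant is such that a perturbation \<open>X\<close> of \<open>Z\<close> below it satisfies
  \<open>\<parallel>b\<parallel>\<parallel>X\<parallel>\<parallel>inv_denom Z\<parallel> \<le> 1/2\<close> in operator norm.\<close>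

definition "radius Z = 1 / (2 * (norm b * \<kappa>\<^sup>2 * norm (inv_denom Z) + 1))"

lemma radius_pos: "radius Z > 0"
  by (simp add: radius_def add_nonneg_pos)

lemma perturbation_bound:
  assumes "X \<in> B2_alpha g W1" "l2norm (blinfun_apply X) < radius Z"
  shows "norm b * norm X * norm (inv_denom Z) \<le> 1 / 2"
proof -
  let ?q = "norm b * \<kappa>\<^sup>2 * norm (inv_denom Z)"
  have half: "q / (2 * (q + 1)) \<le> 1 / 2" if "q \<ge> 0" for q :: real
    using that by (simp add: field_simps)
  have "norm X \<le> \<kappa>\<^sup>2 * l2norm (blinfun_apply X)"
    using assms(1) unfolding B2_alpha_iff[OF B1] by (blast intro: norm_le_l2norm operatorsD(1))
  also have "\<dots> \<le> \<kappa>\<^sup>2 * radius Z" using assms(2) by (intro mult_left_mono) auto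
  finally have "norm b * norm X * norm (inv_denom Z) \<le> norm b * (\<kappa>\<^sup>2 * radius Z) * norm (inv_denom Z)"
    by (intro mult_right_mono mult_left_mono) auto
  also have "\<dots> = ?q / (2 * (?q + 1))" by (simp add: radius_def)
  also have "\<dots> \<le> 1 / 2" by (rule half) simp
  finally show ?thesis .
qed

text \<open>Stability of invertibility: \<open>denom Y = denom Z \<circ> (1 + K)\<close> on \<open>W1\<close> with
  \<open>K = inv_denom Z \<circ> b \<circ> (Y - Z)\<close>.\<close>

lemma U_stable:
  assumes Z: "Z \<in> U" and Y: "Y \<in> B2_alpha g W1"
    and near: "l2norm (blinfun_apply (Y - Z)) < radius Z"
  shows "Y \<in> U"
proof -
  let ?T = "inv_denom Z"
  note T = inv_denom(1)[OF Z]
  define K where "K = ?T o\<^sub>L b o\<^sub>L (Y - Z)"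
  have X: "Y - Z \<in> B2_alpha g W1" using B2_alpha_diff[OF B1 Y U_D(1)[OF Z]] .
  have K_op: "K \<in> operators g W1 W1"
    unfolding K_def using X unfolding B2_alpha_iff[OF B1]
    by (blast intro: operators_compose[OF operators_compose[OF T b]])
  have "norm K \<le> norm ?T * norm b * norm (Y - Z)"
    unfolding K_def by (meson norm_blinfun_compose order_trans mult_right_mono norm_ge_zero)
  hence "norm K < 1" using perturbation_bound[OF X near] by (simp add: mult_ac)
  then obtain R where R: "clinear (blinfun_apply R)" "\<And>x. R (x + K x) = x" "\<And>y. R y + K (R y) = y"
    using inverse_of_perturbed_identity[OF operatorsD(1)[OF K_op]] by blast
  have R_W1: "R y \<in> W1" if "y \<in> W1" for y
  proof -
    have "R y = y - K (R y)" using R(3)[of y] by (simp add: algebra_simps)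
    thus ?thesis
      by (metis cvs.subspace_diff[OF subspaces(1) that operatorsD(2)[OF K_op]])
  qed
  have denom_Y: "denom Y x = denom Z x + b ((Y - Z) x)" for x
    by (simp add: denom_def blinfun.add_left blinfun.diff_left blinfun.diff_right)
  have "is_bounded_inverse g W1 W2 (denom Y) (R o\<^sub>L ?T)"
    unfolding is_bounded_inverse_def
  proof (intro conjI ballI)
    show "R o\<^sub>L ?T \<in> operators g W2 W1"
      using T R(1) R_W1
      by (auto simp: operators_def blinfun.zero_right intro: clinear_blinfun_compose)
  next
    fix v assume v: "v \<in> W1"
    have "?T (denom Y v) = v + K v"
      by (simp add: denom_Y K_def blinfun.add_right inv_denom(2)[OF Z v])
    thus "(R o\<^sub>L ?T) (denom Y v) = v" by (simp add: R(2))
  next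
    fix u assume u: "u \<in> W2"
    let ?x = "R (?T u)"
    have "u = denom Z (?T u)" by (simp add: inv_denom(3)[OF Z u])
    also have "\<dots> = denom Z (?x + K ?x)" by (simp add: R(3))
    also have "\<dots> = denom Z ?x + b ((Y - Z) ?x)"
      by (simp add: blinfun.add_right K_def inv_denom(3)[OF Z operatorsD(2)[OF b]])
    finally show "denom Y ((R o\<^sub>L ?T) u) = u" by (simp add: denom_Y)
  qed
  thus ?thesis using Y by (auto simp: U_def has_bounded_inverse_def)
qed

lemma openin_U: "openin (Metric_space.mtopology (B2_alpha g W1) (\<lambda>X Y. hs_norm g W1 (X - Y))) U"
proof -
  interpret Metric_space "B2_alpha g W1" "\<lambda>X Y. hs_norm g W1 (X - Y)"
    by (rule Metric_space_B2_alpha[OF B1])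
  show ?thesis
    unfolding openin_mtopology
  proof (intro conjI allI impI)
    show "U \<subseteq> B2_alpha g W1" by (auto simp: U_def)
    fix Z assume Z: "Z \<in> U"
    have "mball Z (radius Z) \<subseteq> U"
    proof
      fix Y assume "Y \<in> mball Z (radius Z)"
      hence Y: "Y \<in> B2_alpha g W1" "hs_norm g W1 (Y - Z) < radius Z"
        by (auto simp: in_mball commute[of Z])
      thus "Y \<in> U"
        using U_stable[OF Z Y(1)] hs_norm_B2_alpha[OF B1 B2_alpha_diff[OF B1 Y(1) U_D(1)[OF Z]]]
        by simp
    qed
    thus "\<exists>r>0. mball Z r \<subseteq> U" using radius_pos by blast
  qed
qed

text \<open>In the resolvent identity the second term has at most half the norm of \<open>inv_denom Y\<close> and is
  absorbed by the left side.\<close>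

lemma inv_denom_bound:
  assumes Z: "Z \<in> U" and Y: "Y \<in> U" and near: "l2norm (blinfun_apply (Y - Z)) < radius Z"
  shows "norm (inv_denom Y) \<le> 2 * norm (inv_denom Z)"
proof -
  let ?S = "inv_denom Y" and ?T = "inv_denom Z"
  have X: "Y - Z \<in> B2_alpha g W1" using B2_alpha_diff[OF B1 U_D(1)[OF Y] U_D(1)[OF Z]] .
  have "norm ?S \<le> norm ?T + norm (?T o\<^sub>L b o\<^sub>L (Y - Z) o\<^sub>L ?S)"
    by (subst resolvent_identity[OF Y Z]) (rule norm_triangle_ineq4)
  also have "norm (?T o\<^sub>L b o\<^sub>L (Y - Z) o\<^sub>L ?S) \<le> norm ?T * norm b * norm (Y - Z) * norm ?S"
    by (meson norm_blinfun_compose order_trans mult_right_mono norm_ge_zero)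
  also have "\<dots> = (norm b * norm (Y - Z) * norm ?T) * norm ?S" by (simp add: mult_ac)
  also have "\<dots> \<le> 1 / 2 * norm ?S"
    by (intro mult_right_mono perturbation_bound[OF X near]) simp
  finally show ?thesis by simp
qed

text \<open>With \<open>X = Y - Z\<close> the remainder is \<open>slope Z \<circ> X \<circ> (inv_denom Y - inv_denom Z)\<close>, and the last
  factor is itself of first order in \<open>X\<close> by the resolvent identity.\<close>

lemma quadratic_remainder:
  assumes Z: "Z \<in> U"
  obtains Q where "Q \<ge> 0"
    "\<And>Y. Y \<in> U \<Longrightarrow> l2norm (blinfun_apply (Y - Z)) < radius Z \<Longrightarrow>
      l2norm (blinfun_apply (chart_change Y - chart_change Z - derivative Z (Y - Z)))
        \<le> Q * (l2norm (blinfun_apply (Y - Z)))\<^sup>2"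
proof -
  let ?T = "inv_denom Z"
  define Q where
    "Q = (\<kappa>\<^sup>2 * (2 * norm ?T * norm b * \<kappa>\<^sup>2 * norm ?T)) * (\<kappa>\<^sup>2 * norm (slope Z))"
  have "Q \<ge> 0" by (simp add: Q_def)
  moreover have "l2norm (blinfun_apply (chart_change Y - chart_change Z - derivative Z (Y - Z)))
        \<le> Q * (l2norm (blinfun_apply (Y - Z)))\<^sup>2"
    if Y: "Y \<in> U" and near: "l2norm (blinfun_apply (Y - Z)) < radius Z" for Y
  proof -
    define X where "X = Y - Z"
    let ?S = "inv_denom Y" and ?h = "l2norm (blinfun_apply X)"
    have X: "X \<in> B2_alpha g W1"
      unfolding X_def using B2_alpha_diff[OF B1 U_D(1)[OF Y] U_D(1)[OF Z]] .
    hence X': "X \<in> operators g W1 W1'" "square_summable (blinfun_apply X)"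
      unfolding B2_alpha_iff[OF B1] by auto
    note MX = operators_compose[OF slope_operators[OF Z] X'(1)]
    have TS: "?S - ?T \<in> operators g W2 W1"
      by (intro operators_plus_minus(2) subspaces inv_denom(1) Y Z)
    have eq: "chart_change Y - chart_change Z - derivative Z X = (slope Z o\<^sub>L X) o\<^sub>L (?S - ?T)"
      unfolding chart_change_difference[OF Y Z] derivative_def X_def
      by (rule blinfun_eqI) (simp add: blinfun.diff_left blinfun.diff_right)
    have "?S - ?T = ?S o\<^sub>L b o\<^sub>L (Z - Y) o\<^sub>L ?T"
      using resolvent_identity[OF Z Y] by (simp add: algebra_simps)
    also have "norm \<dots> \<le> norm ?S * norm b * norm (Z - Y) * norm ?T"
      by (meson norm_blinfun_compose order_trans mult_right_mono norm_ge_zero)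
    also have "\<dots> = norm ?S * norm b * norm X * norm ?T"
      by (simp add: X_def norm_minus_commute)
    also have "\<dots> \<le> (2 * norm ?T) * norm b * (\<kappa>\<^sup>2 * ?h) * norm ?T"
      using inv_denom_bound[OF Z Y near] norm_le_l2norm[OF operatorsD(1)[OF X'(1)] X'(2)]
      by (intro mult_right_mono mult_mono) auto
    finally have TS_bound: "norm (?S - ?T) \<le> (2 * norm ?T * norm b * \<kappa>\<^sup>2 * norm ?T) * ?h"
      by (simp add: mult_ac)
    have "l2norm (blinfun_apply ((slope Z o\<^sub>L X) o\<^sub>L (?S - ?T)))
        \<le> (\<kappa>\<^sup>2 * norm (?S - ?T)) * l2norm (blinfun_apply (slope Z o\<^sub>L X))"
      using operatorsD(1)[OF MX] operatorsD(1)[OF TS]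
      by (intro l2norm_compose_right square_summable_compose_left X')
    also have "\<dots> \<le> (\<kappa>\<^sup>2 * ((2 * norm ?T * norm b * \<kappa>\<^sup>2 * norm ?T) * ?h)) * ((\<kappa>\<^sup>2 * norm (slope Z)) * ?h)"
      by (intro mult_mono mult_left_mono TS_bound l2norm_compose_left X') auto
    also have "\<dots> = Q * ?h\<^sup>2" by (simp add: Q_def power2_eq_square mult_ac)
    finally show ?thesis unfolding eq[symmetric] unfolding X_def .
  qed
  ultimately show ?thesis by (rule that)
qed

lemma derivative_bounded_clinear:
  assumes Z: "Z \<in> U"
  shows "bounded_clinear_between (B2_alpha g W1) (hs_norm g W1) (B2_alpha g W2) (hs_norm g W2)
    (derivative Z)"
  unfolding bounded_clinear_between_def
proof (intro conjI ballI allI)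
  show "derivative Z \<in> B2_alpha g W1 \<rightarrow> B2_alpha g W2"
    using derivative_in_B2_alpha[OF Z] by blast
  show "derivative Z (X + Y) = derivative Z X + derivative Z Y" for X Y
    unfolding derivative_def by (rule blinfun_eqI) (simp add: blinfun.add_left blinfun.add_right)
  show "derivative Z (op_cscale k X) = op_cscale k (derivative Z X)" for k X
    unfolding derivative_def
    by (rule blinfun_eqI)
       (simp add: blinfun_apply_op_cscale clinear_cscale[OF operatorsD(1)[OF slope_operators[OF Z]]])
  let ?T = "inv_denom Z"
  show "\<exists>K. \<forall>X\<in>B2_alpha g W1. hs_norm g W2 (derivative Z X) \<le> K * hs_norm g W1 X"
  proof (intro exI ballI)
    fix X assume X: "X \<in> B2_alpha g W1"
    hence X': "X \<in> operators g W1 W1'" "square_summable (blinfun_apply X)"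
      unfolding B2_alpha_iff[OF B1] by auto
    note MX = operators_compose[OF slope_operators[OF Z] X'(1)]
    have "l2norm (blinfun_apply (derivative Z X))
        \<le> (\<kappa>\<^sup>2 * norm ?T) * l2norm (blinfun_apply (slope Z o\<^sub>L X))"
      unfolding derivative_def
      using operatorsD(1)[OF MX] operatorsD(1)[OF inv_denom(1)[OF Z]]
      by (intro l2norm_compose_right square_summable_compose_left X')
    also have "\<dots> \<le> (\<kappa>\<^sup>2 * norm ?T) * ((\<kappa>\<^sup>2 * norm (slope Z)) * l2norm (blinfun_apply X))"
      by (intro mult_left_mono l2norm_compose_left X') simp
    finally show "hs_norm g W2 (derivative Z X)
        \<le> ((\<kappa>\<^sup>2 * norm ?T) * (\<kappa>\<^sup>2 * norm (slope Z))) * hs_norm g W1 X"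
      by (simp add: hs_norm_B2_alpha[OF B1 X] hs_norm_B2_alpha[OF B2 derivative_in_B2_alpha[OF Z X]]
          mult_ac)
  qed
qed

theorem chart_change_holomorphic:
  "holomorphic_between (B2_alpha g W1) (hs_norm g W1) (B2_alpha g W2) (hs_norm g W2) U chart_change"
  unfolding holomorphic_between_def
proof (intro conjI ballI)
  show "openin (Metric_space.mtopology (B2_alpha g W1) (\<lambda>X Y. hs_norm g W1 (X - Y))) U"
    by (rule openin_U)
  show "chart_change \<in> U \<rightarrow> B2_alpha g W2" using chart_change_in_B2_alpha by blast
  fix Z assume Z: "Z \<in> U"
  obtain Q where Q: "Q \<ge> 0"
    "\<And>Y. Y \<in> U \<Longrightarrow> l2norm (blinfun_apply (Y - Z)) < radius Z \<Longrightarrow>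
      l2norm (blinfun_apply (chart_change Y - chart_change Z - derivative Z (Y - Z)))
        \<le> Q * (l2norm (blinfun_apply (Y - Z)))\<^sup>2"
    using quadratic_remainder[OF Z] by blast
  show "\<exists>D. bounded_clinear_between (B2_alpha g W1) (hs_norm g W1) (B2_alpha g W2) (hs_norm g W2) D \<and>
      (\<forall>\<epsilon>>0. \<exists>\<delta>>0. \<forall>Y\<in>U. hs_norm g W1 (Y - Z) < \<delta> \<longrightarrow>
        hs_norm g W2 (chart_change Y - chart_change Z - D (Y - Z)) \<le> \<epsilon> * hs_norm g W1 (Y - Z))"
  proof (intro exI[of _ "derivative Z"] conjI allI impI derivative_bounded_clinear[OF Z])
    fix \<epsilon> :: real assume \<epsilon>: "\<epsilon> > 0"
    define \<delta> where "\<delta> = min (radius Z) (\<epsilon> / (Q + 1))"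
    have "\<delta> > 0" using radius_pos \<epsilon> Q(1) by (simp add: \<delta>_def)
    moreover have "hs_norm g W2 (chart_change Y - chart_change Z - derivative Z (Y - Z)) \<le> \<epsilon> * hs_norm g W1 (Y - Z)"
      if Y: "Y \<in> U" and near: "hs_norm g W1 (Y - Z) < \<delta>" for Y
    proof -
      let ?h = "l2norm (blinfun_apply (Y - Z))"
      have X: "Y - Z \<in> B2_alpha g W1" using B2_alpha_diff[OF B1 U_D(1)[OF Y] U_D(1)[OF Z]] .
      have R: "chart_change Y - chart_change Z - derivative Z (Y - Z) \<in> B2_alpha g W2"
        by (intro B2_alpha_diff[OF B2] chart_change_in_B2_alpha derivative_in_B2_alpha Y Z X)
      have h: "?h < radius Z" "?h < \<epsilon> / (Q + 1)"
        using near by (auto simp: \<delta>_def hs_norm_B2_alpha[OF B1 X])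
      have "Q * ?h \<le> (Q + 1) * ?h" by (intro mult_right_mono) auto
      also have "\<dots> \<le> \<epsilon>" using h(2) Q(1) by (simp add: field_simps)
      finally have "Q * ?h * ?h \<le> \<epsilon> * ?h" by (intro mult_right_mono) auto
      with Q(2)[OF Y h(1)] show ?thesis
        by (simp add: hs_norm_B2_alpha[OF B1 X] hs_norm_B2_alpha[OF B2 R] power2_eq_square mult_ac)
    qed
    ultimately show "\<exists>\<delta>>0. \<forall>Y\<in>U. hs_norm g W1 (Y - Z) < \<delta> \<longrightarrow>
        hs_norm g W2 (chart_change Y - chart_change Z - derivative Z (Y - Z)) \<le> \<epsilon> * hs_norm g W1 (Y - Z)"
      by blast
  qed
qed

end

section \<open>The frame of a compatible triple\<close>

lemma compatible_triple_isometry: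
  assumes "compatible_triple g J \<omega>"
  shows "g (J v) (J w) = g v w"
proof -
  have *: "g v w = \<omega> v (J w)" "\<omega> v w = - \<omega> w v" "J (J v) = - v" "bounded_bilinear \<omega>" for v w
    using assms unfolding compatible_triple_def strong_symplectic_form_def complex_structure_def
    by blast+
  have "g (J v) (J w) = \<omega> (J v) (- w)" by (simp only: *(1,3))
  also have "\<dots> = - \<omega> (J v) w" by (rule bounded_bilinear.minus_right[OF *(4)])
  also have "\<dots> = \<omega> w (J v)" by (simp only: *(2)[of "J v" w] minus_minus)
  also have "\<dots> = g w v" by (simp add: *(1))
  also have "\<dots> = g v w"
    using assms by (simp add: compatible_triple_def strong_inner_product_def)
  finally show ?thesis .
qed

lemma cconj_cspan: "cconj ` cspan B \<subseteq> cspan (cconj ` B)"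
proof -
  have "cspan B \<subseteq> {z. cconj z \<in> cspan (cconj ` B)}"
  proof (rule cvs.span_minimal)
    show "B \<subseteq> {z. cconj z \<in> cspan (cconj ` B)}" by (auto intro: cvs.span_base)
    show "cvs.subspace {z. cconj z \<in> cspan (cconj ` B)}"
      by (simp add: cvs.subspace_def cconj_add cconj_cscale cvs.span_zero cvs.span_add cvs.span_scale)
  qed
  thus ?thesis by blast
qed

lemma closure_cspan_add:
  fixes x y :: "'a::real_normed_vector cplxn"
  assumes "x \<in> closure (cspan B)" "y \<in> closure (cspan B)"
  shows "x + y \<in> closure (cspan B)"
proof -
  obtain p q where "\<And>n. p n \<in> cspan B" "p \<longlonglongrightarrow> x" "\<And>n. q n \<in> cspan B" "q \<longlonglongrightarrow> y"
    using assms unfolding closure_sequential by metis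
  thus ?thesis
    unfolding closure_sequential
    by (intro exI[of _ "\<lambda>n. p n + q n"]) (auto intro: cvs.span_add tendsto_add)
qed

context strong_inner
begin

text \<open>\<open>J\<close> is an isometry with eigenvalue \<open>i\<close> at \<open>z\<close> and \<open>-i\<close> at \<open>\<alpha> w\<close>.\<close>

lemma L_plus_isotropic:
  assumes J: "complex_structure J" "\<And>v w. g (J v) (J w) = g v w"
    and z: "z \<in> L_plus J" and w: "w \<in> L_plus J"
  shows "ip z (cconj w) = 0"
proof -
  have lin: "J (- v) = - J v" for v
    using J(1) by (simp add: complex_structure_def linear_simps)
  have "J_ext J (cconj w) = cconj (J_ext J w)" by (simp add: J_ext_def cconj_def lin)
  also have "\<dots> = cscale (- \<i>) (cconj w)"
    using w by (simp add: L_plus_def cconj_cscale)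
  finally have Jw: "J_ext J (cconj w) = cscale (- \<i>) (cconj w)" .
  have Jz: "J_ext J z = cscale \<i> z" using z by (simp add: L_plus_def)
  have "ip z (cconj w) = ip (J_ext J z) (J_ext J (cconj w))"
    by (simp add: g_ext_def J_ext_def J(2))
  also have "\<dots> = ip (cscale \<i> z) (cscale (- \<i>) (cconj w))" unfolding Jw Jz ..
  also have "\<dots> = - ip z (cconj w)"
    unfolding ip_cscale_left ip_cscale_right by simp
  finally show ?thesis by simp
qed

text \<open>Every \<open>z\<close> is the sum of \<open>(z - iJz)/2 \<in> L\<^sup>+\<close> and \<open>(z + iJz)/2 \<in> \<alpha> L\<^sup>+\<close>.\<close>

lemma L_plus_decomposition:
  assumes J: "complex_structure J"
  obtains p q where "p \<in> L_plus J" "q \<in> L_plus J" "z = p + cconj q"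
proof -
  let ?x = "fst z" and ?y = "snd z"
  have bl: "bounded_linear J" and sq: "J (J v) = - v" for v
    using J by (auto simp: complex_structure_def)
  note lin = linear_simps[OF bl]
  show ?thesis
  proof (rule that[of "(1/2) *\<^sub>R (?x + J ?y, ?y - J ?x)" "(1/2) *\<^sub>R (?x - J ?y, - ?y - J ?x)"])
    show "z = (1/2) *\<^sub>R (?x + J ?y, ?y - J ?x) + cconj ((1/2) *\<^sub>R (?x - J ?y, - ?y - J ?x))"
      by (simp add: cconj_def prod_eq_iff scaleR_add_right[symmetric] scaleR_2[symmetric]
          flip: scaleR_minus_right)
  qed (simp_all add: L_plus_def J_ext_def cscale_def lin sq algebra_simps)
qed

lemma orthonormal_frame_L_plus:
  assumes J: "complex_structure J" "\<And>v w. g (J v) (J w) = g v w"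
    and basis: "orthonormal_basis g (L_plus J) A"
  shows "orthonormal_basis g UNIV (A \<union> cconj ` A)" and "A \<inter> cconj ` A = {}"
proof -
  have A: "orthonormal A" "closure (cspan A) = L_plus J"
    using basis by (auto simp: orthonormal_basis_iff)
  have sub: "A \<subseteq> L_plus J"
    using A(2) closure_subset[of "cspan A"] cvs.span_superset[of A] by blast
  have cross: "ip u (cconj v) = 0" "ip (cconj v) u = 0" if "u \<in> A" "v \<in> A" for u v
  proof -
    show "ip u (cconj v) = 0" using L_plus_isotropic[OF J] sub that by blast
    thus "ip (cconj v) u = 0" by (metis ip_sym complex_cnj_zero)
  qed
  have unit: "ip u v = (if u = v then 1 else 0)" if "u \<in> A" "v \<in> A" for u v
    using A(1) that by (simp add: orthonormal_def)
  show disj: "A \<inter> cconj ` A = {}"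
  proof (rule ccontr)
    assume "A \<inter> cconj ` A \<noteq> {}"
    then obtain u v where "u \<in> A" "v \<in> A" "u = cconj v" by blast
    thus False using cross(1)[of u v] unit[of u u] by simp
  qed
  have "orthonormal (A \<union> cconj ` A)"
    unfolding orthonormal_def
  proof (intro ballI)
    have inj: "cconj u = cconj v \<longleftrightarrow> u = v" for u v :: "'a cplxn" by (metis cconj_cconj)
    fix x y assume "x \<in> A \<union> cconj ` A" "y \<in> A \<union> cconj ` A"
    then consider "x \<in> A" "y \<in> A" | v where "x \<in> A" "v \<in> A" "y = cconj v"
      | u where "u \<in> A" "y \<in> A" "x = cconj u" | u v where "u \<in> A" "v \<in> A" "x = cconj u" "y = cconj v"
      by blast
    thus "ip x y = (if x = y then 1 else 0)"
    proof cases
      case 1 thus ?thesis by (rule unit)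
    next
      case 2 thus ?thesis using cross(1) disj by auto
    next
      case 3 thus ?thesis using cross(2) disj by auto
    next
      case 4 thus ?thesis by (simp add: ip_cconj unit inj)
    qed
  qed
  moreover have "z \<in> closure (cspan (A \<union> cconj ` A))" for z
  proof -
    obtain p q where pq: "p \<in> L_plus J" "q \<in> L_plus J" "z = p + cconj q"
      using L_plus_decomposition[OF J(1)] by blast
    have "p \<in> closure (cspan (A \<union> cconj ` A))"
      using pq(1) A(2) closure_mono[OF cvs.span_mono[of A "A \<union> cconj ` A"]] by auto
    moreover have "cconj q \<in> closure (cspan (A \<union> cconj ` A))"
    proof -
      have "cconj ` closure (cspan A) \<subseteq> closure (cspan (A \<union> cconj ` A))"
      proof (rule image_closure_subset)
        show "continuous_on (closure (cspan A)) cconj"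
          by (rule linear_continuous_on[OF bounded_linear_cconj])
        show "cconj ` cspan A \<subseteq> closure (cspan (A \<union> cconj ` A))"
          using cconj_cspan[of A] cvs.span_mono[of "cconj ` A" "A \<union> cconj ` A"] closure_subset
          by blast
      qed simp
      thus ?thesis using pq(2) A(2) by blast
    qed
    ultimately show ?thesis unfolding pq(3) by (rule closure_cspan_add)
  qed
  ultimately show "orthonormal_basis g UNIV (A \<union> cconj ` A)"
    by (auto simp: orthonormal_basis_iff)
qed

end

definition W_basis :: "nat set \<Rightarrow> (nat \<Rightarrow> 'a::real_vector cplxn) \<Rightarrow> nat set \<Rightarrow> 'a cplxn set" where
  "W_basis I e S = e ` (I - S) \<union> (\<lambda>l. cconj (e l)) ` S"

lemma cconj_W_basis:
  assumes inj: "inj_on e I" and S: "S \<subseteq> I" and disj: "e ` I \<inter> cconj ` e ` I = {}"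
  shows "cconj ` W_basis I e S = (e ` I \<union> cconj ` e ` I) - W_basis I e S"
proof -
  have inj': "inj_on (\<lambda>l. cconj (e l)) I"
    using inj by (auto simp: inj_on_def) (metis cconj_cconj)
  let ?e' = "\<lambda>l. cconj (e l)"
  have diff: "e ` (I - S) = e ` I - e ` S" "?e' ` (I - S) = ?e' ` I - ?e' ` S"
    using S by (auto intro!: inj_on_image_set_diff[OF inj] inj_on_image_set_diff[OF inj'])
  have conj: "cconj ` W_basis I e S = e ` S \<union> ?e' ` (I - S)"
    by (simp add: W_basis_def image_Un image_image Un_commute)
  have "e ` S \<subseteq> e ` I" "?e' ` S \<subseteq> ?e' ` I" "e ` I \<inter> ?e' ` I = {}"
    using S disj by (auto simp: image_image)
  hence "e ` S \<union> (?e' ` I - ?e' ` S) = (e ` I \<union> ?e' ` I) - ((e ` I - e ` S) \<union> ?e' ` S)"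
    by blast
  thus ?thesis unfolding conj unfolding W_basis_def diff by (simp add: image_image)
qed

theorem theorem5p11:
  fixes g \<omega> :: "'a::{real_inner, polish_space} \<Rightarrow> 'a \<Rightarrow> real"
    and J :: "'a \<Rightarrow> 'a"
    and I S1 S2 :: "nat set"
    and e :: "nat \<Rightarrow> 'a cplxn"
    and W1 W2 :: "'a cplxn set"
    and a b c d :: "'a cplxn \<Rightarrow>\<^sub>L 'a cplxn"
  assumes triple: "compatible_triple g J \<omega>"
    and index_set: "I = {1..} \<or> (\<exists>n. I = {1..n})"
    and inj: "inj_on e I"
    and basis: "orthonormal_basis g (L_plus J) (e ` I)"
    and S1: "finite S1" "S1 \<subseteq> I"
    and S2: "finite S2" "S2 \<subseteq> I"
    and W1: "W1 = W_space I e S1"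
    and W2: "W2 = W_space I e S2"
    and a: "a \<in> operators g W1 W2"
    and b: "b \<in> operators g (perp g W1) W2"
    and c: "c \<in> operators g W1 (perp g W2)"
    and d: "d \<in> operators g (perp g W1) (perp g W2)"
    and identity: "\<forall>v\<in>W1. \<forall>w\<in>perp g W1. (a v + b w) + (c v + d w) = v + w"
  shows "holomorphic_between (B2_alpha g W1) (hs_norm g W1) (B2_alpha g W2) (hs_norm g W2)
           {Z \<in> B2_alpha g W1. has_bounded_inverse g W1 W2 (a + (b o\<^sub>L Z))}
           (\<lambda>Z. (c + (d o\<^sub>L Z)) o\<^sub>L inverse_operator g W1 W2 (a + (b o\<^sub>L Z)))"
proof -
  interpret strong_inner g
    using triple by unfold_locales (simp add: compatible_triple_def)
  have J: "complex_structure J" using triple by (simp add: compatible_triple_def)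
  define E where "E = e ` I \<union> cconj ` e ` I"
  note E_basis = orthonormal_frame_L_plus[OF J compatible_triple_isometry[OF triple] basis]
  interpret orthonormal_frame g E
    using E_basis(1) by unfold_locales (simp add: E_def)
  have polarizing: "polarizing (W_basis I e S)" if "S \<subseteq> I" for S
    unfolding polarizing_def
  proof
    show "W_basis I e S \<subseteq> E" using that by (auto simp: W_basis_def E_def)
    show "cconj ` W_basis I e S = E - W_basis I e S"
      unfolding E_def by (rule cconj_W_basis[OF inj that E_basis(2)])
  qed
  have coord: "W1 = coord (W_basis I e S1)" "W2 = coord (W_basis I e S2)"
    by (simp_all add: W1 W2 coord_def W_space_def W_basis_def)
  note perp = perp_coord[OF polarizing_subset[OF polarizing]]
  have finite: "finite (W_basis I e S1 - W_basis I e S2)"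
  proof (rule finite_subset)
    show "W_basis I e S1 - W_basis I e S2 \<subseteq> e ` S2 \<union> (\<lambda>l. cconj (e l)) ` S1"
      by (auto simp: W_basis_def)
  qed (use S1 S2 in simp)
  interpret transition g E "W_basis I e S1" "W_basis I e S2" a b c d
    using polarizing[OF S1(2)] polarizing[OF S2(2)] finite a b c d identity
    unfolding coord perp[OF S1(2)] perp[OF S2(2)] by unfold_locales auto
  have "chart_change = (\<lambda>Z. (c + (d o\<^sub>L Z)) o\<^sub>L inverse_operator g W1 W2 (a + (b o\<^sub>L Z)))"
    by (auto simp: fun_eq_iff chart_change_def numer_def inv_denom_def denom_def coord)
  moreover have "U = {Z \<in> B2_alpha g W1. has_bounded_inverse g W1 W2 (a + (b o\<^sub>L Z))}"
    by (simp add: U_def denom_def coord)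
  ultimately show ?thesis using chart_change_holomorphic by (simp add: coord)
qed

end
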